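(* Let $\mathcal{A}$ be either an involutive Hopf algebra, or a coquasi-triangular $*$-bialgebra whose universal R-form $r$ satisfies $r=\overline{\phantom{a}}\circ\bar r\circ( *\otimes* )$, and let $(\mathcal{C}_*(\mathcal{A}),\Psi)$ be the associated braided category. If $(\mathcal{B},\Delta_{\mathcal B},\varepsilon_{\mathcal B},m_{\mathcal B},1_{\mathcal B},\Psi,*_{\mathcal B})$ is a braided $*$-bialgebra in $(\mathcal{C}_*(\mathcal{A}),\Psi)$ with action $\alpha$ and coaction $\gamma$, then the vector space $H=\mathcal{B}\otimes\mathcal{A}$ becomes a $*$-bialgebra with $$m_H=(m_{\mathcal B}\otimes m_{\mathcal A})\circ(\mathrm{id}\otimes\alpha\otimes\mathrm{id}\otimes\mathrm{id})\circ(\mathrm{id}\otimes\mathrm{id}\otimes\tau\otimes\mathrm{id})\circ(\mathrm{id}\otimes\Delta_{\mathcal A}\otimes\mathrm{id}\otimes\mathrm{id}),\quad 1_H=1_{\mathcal B}\otimes1_{\mathcal A},$$ $$\Delta_H=(\mathrm{id}\otimes m_{\mathcal A}\otimes\mathrm{id}\otimes\mathrm{id})\circ(\mathrm{id}\otimes\mathrm{id}\otimes\tau\otimes\mathrm{id})\circ(\mathrm{id}\otimes\gamma\otimes\mathrm{id}\otimes\mathrm{id})\circ(\Delta_{\mathcal B}\otimes\Delta_{\mathcal A}),\quad\varepsilon_H=\varepsilon_{\mathcal B}\otimes\varepsilon_{\mathcal A},$$ $$*_H=(\alpha\otimes\mathrm{id})\circ(\tau\otimes\mathrm{id})\circ(\mathrm{id}\otimes\Delta_{\mathcal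 A})\circ( *_{\mathcal B}\otimes*_{\mathcal A}).$$ The map $\mathrm{id}_{\mathcal B}\otimes1_{\mathcal A}:\mathcal{B}\to\mathcal{B}\otimes1_{\mathcal A}\subseteq H$ is a $*$-algebra isomorphism onto its image. Furthermore $$\Delta_H\circ(\mathrm{id}_{\mathcal B}\otimes1_{\mathcal A})=(\mathrm{id}_{\mathcal B}\otimes\gamma\otimes1_{\mathcal A})\circ\Delta_{\mathcal B}\quad\text{and}\quad(\mathrm{id}_{\mathcal B}\otimes\varepsilon_{\mathcal A}\otimes\mathrm{id}_{\mathcal B}\otimes\varepsilon_{\mathcal A})\circ\Delta_H=\Delta_{\mathcal B}\circ(\mathrm{id}_{\mathcal B}\otimes\varepsilon_{\mathcal A}).$$
   Context: All spaces are complex; $\tau$ denotes flips. Sweedler notation: $\Delta(a)=a_{(1)}\otimes a_{(2)}$; for a left coaction $\gamma:V\to\mathcal{A}\otimes V$, $\gamma(v)=v_{(-1)}\otimes v_{(0)}$; for a left action $\alpha:\mathcal{A}\otimes V\to V$, $a\cdot v=\alpha(a\otimes v)$. In this notation $(b\otimes a)(d\otimes c)=b(a_{(1)}\cdot d)\otimes a_{(2)}c$, $\Delta_H(b\otimes a)=b_{(1)}\otimes (b_{(2)})_{(-1)}a_{(1)}\otimes(b_{(2)})_{(0)}\otimes a_{(2)}$, $(b\otimes a)^{*}=(a_{(1)})^*\cdot b^*\otimes(a_{(2)})^*$. Category, Hopf case: $\mathcal{A}$ is a Hopf $*$-algebra with antipode $S$. Objects are complex vector spaces $V$ with left action, left coaction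 and anti-linear involution such that $a_{(1)}v_{(-1)}\otimes a_{(2)}\cdot v_{(0)}=(a_{(1)}\cdot v)_{(-1)}a_{(2)}\otimes(a_{(1)}\cdot v)_{(0)}$, $(a\cdot v)^*=S(a)^*\cdot v^*$, $\gamma(v^* )=(v_{(-1)})^*\otimes(v_{(0)})^*$. Category, coquasi-triangular case: $\mathcal{A}$ is a $*$-bialgebra with a convolution-invertible functional $r:\mathcal{A}\otimes\mathcal{A}\to\mathbb{C}$ (inverse $\bar r$) with $m^{\rm op}=r\star m\star\bar r$, $r\circ(m\otimes\mathrm{id})=r_{13}\star r_{23}$, $r\circ(\mathrm{id}\otimes m)=r_{13}\star r_{12}$, and $r(a\otimes b)=\overline{\bar r(a^*\otimes b^* )}$. Objects are complex vector spaces $V$ with a left coaction and an anti-linear involution with $\gamma(v^* )=(v_{(-1)})^*\otimes(v_{(0)})^*$; the action used is $\alpha=(\bar r\otimes\mathrm{id})\circ(\mathrm{id}\otimes\gamma)$. In both cases morphisms are the linear maps that are module and comodule maps, tensor products carry the diagonal action and codiagonal coaction, the braiding is $\Psi_{V,W}(v\otimes w)=v_{(-1)}\cdot w\otimes v_{(0)}$, and the involution on $V\otimes W$ is $(v\otimes w)^*=\Psi_{W,V}(w^*\otimes v^* )$. A braided $*$-bialgebra $\mathcal{B}$ in this category is an object $\mathcal{B}$ with morphisms $m_{\mathcal B},1_{\mathcal B},\Delta_{\mathcal B},\varepsilon_{\mathcal B}$ making it a unital associative algebra and a counital coassociative coalgebra, with $\varepsilon_{\mathcal B}$ an algebra homomorphism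 and $\Delta_{\mathcal B}:\mathcal{B}\to\mathcal{B}\otimes\mathcal{B}$ an algebra homomorphism for the product $(m_{\mathcal B}\otimes m_{\mathcal B})\circ(\mathrm{id}\otimes\Psi\otimes\mathrm{id})$ on $\mathcal{B}\otimes\mathcal{B}$, such that $\mathcal{B}$ is a $*$-algebra and $\Delta_{\mathcal B}$ is a $*$-homomorphism for the involution $\Psi\circ( *\otimes* )\circ\tau$ on $\mathcal{B}\otimes\mathcal{B}$. *)

theory Defs
  imports Complex_Main "HOL-Library.Poly_Mapping"
begin

section \<open>Complex vector spaces\<close>

class complex_vector = ab_group_add +
  fixes scaleC :: "complex \<Rightarrow> 'a \<Rightarrow> 'a" (infixr "*\<^sub>C" 75)
  assumes scaleC_add_right: "c *\<^sub>C (x + y) = c *\<^sub>C x + c *\<^sub>C y"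
    and scaleC_add_left: "(c + d) *\<^sub>C x = c *\<^sub>C x + d *\<^sub>C x"
    and scaleC_scaleC: "c *\<^sub>C d *\<^sub>C x = (c * d) *\<^sub>C x"
    and scaleC_one: "1 *\<^sub>C x = x"

interpretation complex_vector: vector_space "scaleC :: complex \<Rightarrow> 'a \<Rightarrow> 'a::complex_vector"
  by unfold_locales (simp_all add: scaleC_add_right scaleC_add_left scaleC_scaleC scaleC_one)

abbreviation clinear :: "('a::complex_vector \<Rightarrow> 'b::complex_vector) \<Rightarrow> bool"
  where "clinear \<equiv> Vector_Spaces.linear scaleC scaleC"

definition antilinear :: "('a::complex_vector \<Rightarrow> 'b::complex_vector) \<Rightarrow> bool"
  where "antilinear f \<longleftrightarrow> additive f \<and> (\<forall>c x. f (c *\<^sub>C x) = cnj c *\<^sub>C f x)"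

lemma clinear_iff:
  "clinear f \<longleftrightarrow> additive f \<and> (\<forall>c x. f (c *\<^sub>C x) = c *\<^sub>C f x)"
  by (auto simp: additive_def Vector_Spaces.linear_def module_hom_def module_hom_axioms_def
      complex_vector.vector_space_axioms complex_vector.module_axioms)

instantiation complex :: complex_vector
begin

definition scaleC_complex :: "complex \<Rightarrow> complex \<Rightarrow> complex"
  where [simp]: "scaleC_complex c x = c * x"

instance
  by standard (simp_all add: algebra_simps)

end

instantiation poly_mapping :: (type, complex_vector) complex_vector
begin

definition scaleC_poly_mapping :: "complex \<Rightarrow> ('a \<Rightarrow>\<^sub>0 'b) \<Rightarrow> 'a \<Rightarrow>\<^sub>0 'b"
  where "scaleC_poly_mapping c = Poly_Mapping.map (scaleC c)"

lemma lookup_scaleC [simp]: "poly_mapping.lookup (c *\<^sub>C p) k = c *\<^sub>C poly_mapping.lookup p k"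
  by (simp add: scaleC_poly_mapping_def Poly_Mapping.map.rep_eq when_def)

instance
  by standard (simp_all add: poly_mapping_eq_iff fun_eq_iff lookup_add
      scaleC_add_right scaleC_add_left scaleC_scaleC scaleC_one)

end


section \<open>Tensor product of complex vector spaces\<close>

definition tensor_relators :: "(('a::complex_vector \<times> 'b::complex_vector) \<Rightarrow>\<^sub>0 complex) set"
  where "tensor_relators =
    {Poly_Mapping.single (a + a', b) 1 - Poly_Mapping.single (a, b) 1 - Poly_Mapping.single (a', b) 1 | a a' b. True} \<union>
    {Poly_Mapping.single (a, b + b') 1 - Poly_Mapping.single (a, b) 1 - Poly_Mapping.single (a, b') 1 | a b b'. True} \<union>
    {Poly_Mapping.single (c *\<^sub>C a, b) 1 - c *\<^sub>C Poly_Mapping.single (a, b) 1 | c a b. True} \<union>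
    {Poly_Mapping.single (a, c *\<^sub>C b) 1 - c *\<^sub>C Poly_Mapping.single (a, b) 1 | c a b. True}"

definition tensor_rel ::
  "(('a::complex_vector \<times> 'b::complex_vector) \<Rightarrow>\<^sub>0 complex) \<Rightarrow> (('a \<times> 'b) \<Rightarrow>\<^sub>0 complex) \<Rightarrow> bool"
  where "tensor_rel p q \<longleftrightarrow> p - q \<in> complex_vector.span tensor_relators"

lemma equivp_tensor_rel: "equivp tensor_rel"
proof (rule equivpI)
  show "reflp tensor_rel"
    by (simp add: reflp_def tensor_rel_def complex_vector.span_zero)
  show "symp tensor_rel"
    unfolding symp_def tensor_rel_def
    by (metis complex_vector.span_neg minus_diff_eq)
  show "transp tensor_rel"
    unfolding transp_def tensor_rel_def
    by (auto dest: complex_vector.span_add)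
qed

quotient_type (overloaded) ('a, 'b) tensor (infixr "\<otimes>" 80) =
  "('a::complex_vector \<times> 'b::complex_vector) \<Rightarrow>\<^sub>0 complex" / tensor_rel
  by (rule equivp_tensor_rel)

instantiation tensor :: (complex_vector, complex_vector) complex_vector
begin

lift_definition zero_tensor :: "'a \<otimes> 'b" is 0 .

lift_definition plus_tensor :: "'a \<otimes> 'b \<Rightarrow> 'a \<otimes> 'b \<Rightarrow> 'a \<otimes> 'b" is "(+)"
  by (simp add: tensor_rel_def add_diff_add complex_vector.span_add)

lift_definition uminus_tensor :: "'a \<otimes> 'b \<Rightarrow> 'a \<otimes> 'b" is uminus
  unfolding tensor_rel_def by (drule complex_vector.span_neg) simp

lift_definition minus_tensor :: "'a \<otimes> 'b \<Rightarrow> 'a \<otimes> 'b \<Rightarrow> 'a \<otimes> 'b" is "(-)"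
proof -
  fix p p' q q' :: "('a \<times> 'b) \<Rightarrow>\<^sub>0 complex"
  assume "tensor_rel p p'" "tensor_rel q q'"
  moreover have "(p - q) - (p' - q') = (p - p') - (q - q')"
    by (simp add: algebra_simps)
  ultimately show "tensor_rel (p - q) (p' - q')"
    unfolding tensor_rel_def by (metis complex_vector.span_diff)
qed

lift_definition scaleC_tensor :: "complex \<Rightarrow> 'a \<otimes> 'b \<Rightarrow> 'a \<otimes> 'b" is scaleC
  unfolding tensor_rel_def complex_vector.scale_right_diff_distrib[symmetric]
  by (rule complex_vector.span_scale)

instance
proof
  fix x y z :: "'a \<otimes> 'b" and c d :: complex
  have refl: "tensor_rel p p" for p :: "('a \<times> 'b) \<Rightarrow>\<^sub>0 complex"
    by (simp add: tensor_rel_def complex_vector.span_zero)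
  show "x + y + z = x + (y + z)"
    by transfer (simp add: add.assoc refl)
  show "x + y = y + x"
    by transfer (simp add: add.commute refl)
  show "0 + x = x"
    by transfer (simp add: refl)
  show "- x + x = 0"
    by transfer (simp add: refl)
  show "x - y = x + - y"
    by transfer (simp add: refl)
  show "c *\<^sub>C (x + y) = c *\<^sub>C x + c *\<^sub>C y"
    by transfer (simp add: scaleC_add_right refl)
  show "(c + d) *\<^sub>C x = c *\<^sub>C x + d *\<^sub>C x"
    by transfer (simp add: scaleC_add_left refl)
  show "c *\<^sub>C d *\<^sub>C x = (c * d) *\<^sub>C x"
    by transfer (simp add: scaleC_scaleC refl)
  show "1 *\<^sub>C x = x"
    by transfer (simp add: scaleC_one refl)
qed

end

lift_definition pure_tensor :: "'a::complex_vector \<Rightarrow> 'b::complex_vector \<Rightarrow> 'a \<otimes> 'b" (infixr "\<otimes>" 80)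
  is "\<lambda>a b. Poly_Mapping.single (a, b) 1" .

lemma
  shows tensor_add_left: "(a + a') \<otimes> b = a \<otimes> b + a' \<otimes> b"
    and tensor_add_right: "a \<otimes> (b + b') = a \<otimes> b + a \<otimes> b'"
    and tensor_scaleC_left: "(c *\<^sub>C a) \<otimes> b = c *\<^sub>C (a \<otimes> b)"
    and tensor_scaleC_right: "a \<otimes> (c *\<^sub>C b) = c *\<^sub>C (a \<otimes> b)"
  by (transfer; unfold tensor_rel_def diff_diff_eq[symmetric];
      rule complex_vector.span_base; force simp: tensor_relators_def)+

lemma tensor_induct [case_names zero pure add]:
  fixes t :: "'a::complex_vector \<otimes> 'b::complex_vector"
  assumes zero: "P 0"
    and pure: "\<And>a b. P (a \<otimes> b)"
    and add: "\<And>s t. P s \<Longrightarrow> P t \<Longrightarrow> P (s + t)"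
  shows "P t"
proof -
  have single: "abs_tensor (Poly_Mapping.single ab c) = (c *\<^sub>C fst ab) \<otimes> snd ab"
    for ab :: "'a \<times> 'b" and c
  proof -
    have "Poly_Mapping.single ab c = c *\<^sub>C Poly_Mapping.single ab 1"
      by (auto simp: poly_mapping_eq_iff fun_eq_iff lookup_single when_def)
    moreover have "abs_tensor (c *\<^sub>C Poly_Mapping.single ab 1) = c *\<^sub>C (fst ab \<otimes> snd ab)"
      by (simp add: pure_tensor.abs_eq scaleC_tensor.abs_eq)
    ultimately show ?thesis
      by (simp add: tensor_scaleC_left)
  qed
  have "P (abs_tensor p)" for p :: "('a \<times> 'b) \<Rightarrow>\<^sub>0 complex"
  proof (induction p rule: update_induct)
    case const
    then show ?case
      using zero by (simp add: zero_tensor_def)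
  next
    case (update p k c)
    then have "Poly_Mapping.update k c p = Poly_Mapping.single k c + p"
      by (auto simp: poly_mapping_eq_iff fun_eq_iff lookup_update lookup_add lookup_single
          when_def in_keys_iff)
    then show ?case
      using add[OF pure update(3)] by (simp add: plus_tensor.abs_eq[symmetric] single)
  qed
  then show ?thesis
    by (metis Quotient3_abs_rep Quotient3_tensor)
qed

definition balanced :: "('a::complex_vector \<Rightarrow> 'b::complex_vector \<Rightarrow> 'c::ab_group_add) \<Rightarrow> bool"
  where "balanced f \<longleftrightarrow> (\<forall>b. additive (\<lambda>a. f a b)) \<and> (\<forall>a. additive (f a)) \<and>
    (\<forall>c a b. f (c *\<^sub>C a) b = f a (c *\<^sub>C b))"

text \<open>
  The extension of a map given on pure tensors is characterised by additivity alone, so that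
  it covers bilinear maps as well as maps that are antilinear in both arguments
  (such as \<open>\<lambda>a b. a\<^sup>* \<otimes> b\<^sup>*\<close>).
\<close>

definition tensor_lift ::
  "('a::complex_vector \<Rightarrow> 'b::complex_vector \<Rightarrow> 'c::ab_group_add) \<Rightarrow> 'a \<otimes> 'b \<Rightarrow> 'c"
  where "tensor_lift f = (THE h. additive h \<and> (\<forall>a b. h (a \<otimes> b) = f a b))"

lemma additive_eq_on_tensors:
  assumes "additive g" "additive h" "\<And>a b. g (a \<otimes> b) = h (a \<otimes> b)"
  shows "g = h"
proof
  fix t
  show "g t = h t"
    by (induction t rule: tensor_induct)
      (simp_all add: assms additive.zero[OF assms(1)] additive.zero[OF assms(2)]
        additive.add[OF assms(1)] additive.add[OF assms(2)])
qed

lemma tensor_lift_exists: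
  assumes f: "balanced f"
  shows "\<exists>h. additive h \<and> (\<forall>a b. h (a \<otimes> b) = f a b)"
proof -
  define F where "F p = (\<Sum>k\<in>Poly_Mapping.keys p. f (poly_mapping.lookup p k *\<^sub>C fst k) (snd k))" for p
  have f1: "f (a + a') b = f a b + f a' b" and f2: "f a (b + b') = f a b + f a b'"
    and f3: "f (c *\<^sub>C a) b = f a (c *\<^sub>C b)" for a a' b b' c
    using f by (auto simp: balanced_def additive_def)
  have f0: "f 0 b = 0" for b
    using f1[of 0 0 b] by simp
  have F_add: "F (p + q) = F p + F q" for p q
    unfolding F_def
    using setsum_keys_plus_distrib[of "\<lambda>k c. f (c *\<^sub>C fst k) (snd k)" p q]
    by (simp add: f0 f1 scaleC_add_left)
  then have F: "additive F"
    by (simp add: additive_def)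
  have F_single: "F (Poly_Mapping.single (a, b) c) = f (c *\<^sub>C a) b" for a b c
    by (simp add: F_def f0)
  have scale_single: "c *\<^sub>C Poly_Mapping.single k d = Poly_Mapping.single k (c * d)"
    for c d and k :: "'a \<times> 'b"
    by (auto simp: poly_mapping_eq_iff fun_eq_iff lookup_single when_def)
  have gen: "F (c *\<^sub>C p) = 0" if "p \<in> tensor_relators" for p c
    using that unfolding tensor_relators_def
    by (auto simp: complex_vector.scale_right_diff_distrib scale_single additive.diff[OF F]
        F_single scaleC_add_right f1 f2 f3 scaleC_scaleC mult.commute)
  have ker: "F p = 0" if "p \<in> complex_vector.span tensor_relators" for p
  proof -
    have "\<forall>c. F (c *\<^sub>C p) = 0"
      using that
      by (induction rule: complex_vector.span_induct_alt)
        (simp_all add: additive.zero[OF F] scaleC_add_right scaleC_scaleC F_add gen)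
    then have "F (1 *\<^sub>C p) = 0"
      by blast
    then show ?thesis
      by (simp add: scaleC_one)
  qed
  define h where "h t = F (rep_tensor t)" for t
  have h_abs: "h (abs_tensor p) = F p" for p
  proof -
    have "tensor_rel (rep_tensor (abs_tensor p)) p"
      by (metis Quotient3_def Quotient3_tensor tensor.abs_eq_iff)
    then show ?thesis
      unfolding h_def tensor_rel_def using ker additive.diff[OF F] by fastforce
  qed
  have "h (s + t) = h s + h t" for s t
    by (induct s, induct t) (simp add: plus_tensor.abs_eq h_abs F_add)
  then have "additive h"
    by (simp add: additive_def)
  moreover have "h (a \<otimes> b) = f a b" for a b
    by (simp add: pure_tensor.abs_eq h_abs F_single scaleC_one)
  ultimately show ?thesis
    by blast
qed

lemma tensor_lift_spec:
  assumes "balanced f"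
  shows "additive (tensor_lift f) \<and> (\<forall>a b. tensor_lift f (a \<otimes> b) = f a b)"
proof -
  obtain h where h: "additive h \<and> (\<forall>a b. h (a \<otimes> b) = f a b)"
    using tensor_lift_exists[OF assms] by blast
  show ?thesis
    unfolding tensor_lift_def
    by (rule theI[of _ h]) (use h additive_eq_on_tensors[of _ h] in auto)
qed

lemmas additive_tensor_lift = tensor_lift_spec[THEN conjunct1]
lemmas tensor_lift_pure = tensor_lift_spec[THEN conjunct2, rule_format]

lemma clinear_tensor_lift:
  assumes f: "balanced f" and "\<And>c a b. f (c *\<^sub>C a) b = c *\<^sub>C f a b"
  shows "clinear (tensor_lift f)"
proof -
  have "tensor_lift f (c *\<^sub>C t) = c *\<^sub>C tensor_lift f t" for c t
    by (induction t rule: tensor_induct)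
      (simp_all add: assms additive.zero[OF additive_tensor_lift[OF f]] scaleC_add_right
        additive.add[OF additive_tensor_lift[OF f]] tensor_lift_pure[OF f]
        tensor_scaleC_left[symmetric])
  then show ?thesis
    by (simp add: clinear_iff additive_tensor_lift[OF f])
qed

definition tensor_map ::
  "('a::complex_vector \<Rightarrow> 'c::complex_vector) \<Rightarrow> ('b::complex_vector \<Rightarrow> 'd::complex_vector) \<Rightarrow>
    'a \<otimes> 'b \<Rightarrow> 'c \<otimes> 'd" (infixr "\<otimes>\<^sub>m" 80)
  where "f \<otimes>\<^sub>m g = tensor_lift (\<lambda>a b. f a \<otimes> g b)"

definition flip :: "'a::complex_vector \<otimes> 'b::complex_vector \<Rightarrow> 'b \<otimes> 'a"
  where "flip = tensor_lift (\<lambda>a b. b \<otimes> a)"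

definition assoc :: "('a::complex_vector \<otimes> 'b::complex_vector) \<otimes> 'c::complex_vector \<Rightarrow> 'a \<otimes> ('b \<otimes> 'c)"
  where "assoc = tensor_lift (\<lambda>t c. tensor_lift (\<lambda>a b. a \<otimes> (b \<otimes> c)) t)"

definition assoc' :: "'a::complex_vector \<otimes> ('b::complex_vector \<otimes> 'c::complex_vector) \<Rightarrow> ('a \<otimes> 'b) \<otimes> 'c"
  where "assoc' = tensor_lift (\<lambda>a t. tensor_lift (\<lambda>b c. (a \<otimes> b) \<otimes> c) t)"

definition lunit :: "complex \<otimes> 'a::complex_vector \<Rightarrow> 'a"
  where "lunit = tensor_lift (\<lambda>c a. c *\<^sub>C a)"

definition runit :: "'a::complex_vector \<otimes> complex \<Rightarrow> 'a"
  where "runit = tensor_lift (\<lambda>a c. c *\<^sub>C a)"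

lemma tensor_map_clinear:
  assumes "clinear f" "clinear g"
  shows "clinear (f \<otimes>\<^sub>m g)" "(f \<otimes>\<^sub>m g) (a \<otimes> b) = f a \<otimes> g b"
proof -
  have "balanced (\<lambda>a b. f a \<otimes> g b)"
    using assms by (simp add: balanced_def clinear_iff additive_def tensor_add_left
        tensor_add_right tensor_scaleC_left tensor_scaleC_right)
  moreover have "f (c *\<^sub>C a) \<otimes> g b = c *\<^sub>C (f a \<otimes> g b)" for c a b
    using assms by (simp add: clinear_iff tensor_scaleC_left)
  ultimately show "clinear (f \<otimes>\<^sub>m g)" "(f \<otimes>\<^sub>m g) (a \<otimes> b) = f a \<otimes> g b"
    by (simp_all add: tensor_map_def clinear_tensor_lift tensor_lift_pure)
qed

lemma tensor_map_antilinear: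
  assumes "antilinear f" "antilinear g"
  shows "antilinear (f \<otimes>\<^sub>m g)" "(f \<otimes>\<^sub>m g) (a \<otimes> b) = f a \<otimes> g b"
proof -
  have bal: "balanced (\<lambda>a b. f a \<otimes> g b)"
    using assms by (simp add: balanced_def antilinear_def additive_def tensor_add_left
        tensor_add_right tensor_scaleC_left tensor_scaleC_right)
  then show pure: "(f \<otimes>\<^sub>m g) (a \<otimes> b) = f a \<otimes> g b" for a b
    by (simp add: tensor_map_def tensor_lift_pure)
  have add: "additive (f \<otimes>\<^sub>m g)"
    using bal by (simp add: tensor_map_def additive_tensor_lift)
  have "(f \<otimes>\<^sub>m g) (c *\<^sub>C t) = cnj c *\<^sub>C (f \<otimes>\<^sub>m g) t" for c t
  proof (induction t rule: tensor_induct)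
    case (pure a b)
    then show ?case
      using assms unfolding tensor_scaleC_left[symmetric] \<open>\<And>b a. (f \<otimes>\<^sub>m g) (a \<otimes> b) = f a \<otimes> g b\<close>
      by (simp add: antilinear_def tensor_scaleC_left)
  qed (simp_all add: additive.zero[OF add] additive.add[OF add] scaleC_add_right)
  with add show "antilinear (f \<otimes>\<^sub>m g)"
    by (simp add: antilinear_def)
qed

lemma balanced_flip: "balanced (\<lambda>a b. b \<otimes> a)"
  by (simp add: balanced_def additive_def tensor_add_left tensor_add_right
      tensor_scaleC_left tensor_scaleC_right)

lemma flip_clinear: "clinear flip"
  unfolding flip_def by (rule clinear_tensor_lift[OF balanced_flip]) (simp add: tensor_scaleC_right)

lemma flip_pure: "flip (a \<otimes> b) = b \<otimes> a"
  by (simp add: flip_def tensor_lift_pure[OF balanced_flip])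

lemma balanced_lunit: "balanced (\<lambda>c a. c *\<^sub>C a)"
  by (simp add: balanced_def additive_def scaleC_add_left scaleC_add_right scaleC_scaleC mult.commute)

lemma lunit_clinear: "clinear lunit"
  unfolding lunit_def by (rule clinear_tensor_lift[OF balanced_lunit]) (simp add: scaleC_scaleC)

lemma lunit_pure: "lunit (c \<otimes> a) = c *\<^sub>C a"
  by (simp add: lunit_def tensor_lift_pure[OF balanced_lunit])

lemma balanced_runit: "balanced (\<lambda>a c. c *\<^sub>C a)"
  by (simp add: balanced_def additive_def scaleC_add_left scaleC_add_right scaleC_scaleC mult.commute)

lemma runit_clinear: "clinear runit"
  unfolding runit_def
  by (rule clinear_tensor_lift[OF balanced_runit]) (simp add: scaleC_scaleC mult.commute)

lemma runit_pure: "runit (a \<otimes> c) = c *\<^sub>C a"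
  by (simp add: runit_def tensor_lift_pure[OF balanced_runit])

lemma balanced_assoc_inner: "balanced (\<lambda>a b. a \<otimes> (b \<otimes> c))"
  by (simp add: balanced_def additive_def tensor_add_left tensor_add_right
      tensor_scaleC_left tensor_scaleC_right)

lemma clinear_assoc_inner: "clinear (tensor_lift (\<lambda>a b. a \<otimes> (b \<otimes> c)))"
  by (rule clinear_tensor_lift[OF balanced_assoc_inner]) (simp add: tensor_scaleC_left)

lemma clinear_assoc_outer: "clinear (\<lambda>c. tensor_lift (\<lambda>a b. a \<otimes> (b \<otimes> c)) t)"
proof (induction t rule: tensor_induct)
  case (pure a b)
  then show ?case
    by (simp add: clinear_iff additive_def tensor_lift_pure[OF balanced_assoc_inner]
        tensor_add_right tensor_scaleC_right)
qed (simp_all add: clinear_iff additive_def scaleC_add_right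
      additive.zero[OF additive_tensor_lift[OF balanced_assoc_inner]]
      additive.add[OF additive_tensor_lift[OF balanced_assoc_inner]])

lemma balanced_assoc: "balanced (\<lambda>t c. tensor_lift (\<lambda>a b. a \<otimes> (b \<otimes> c)) t)"
  by (simp add: balanced_def clinear_assoc_inner[unfolded clinear_iff]
      clinear_assoc_outer[unfolded clinear_iff])

lemma assoc_clinear: "clinear assoc"
  unfolding assoc_def
  by (rule clinear_tensor_lift[OF balanced_assoc]) (simp add: clinear_assoc_inner[unfolded clinear_iff])

lemma assoc_pure: "assoc ((a \<otimes> b) \<otimes> c) = a \<otimes> (b \<otimes> c)"
  by (simp add: assoc_def tensor_lift_pure[OF balanced_assoc] tensor_lift_pure[OF balanced_assoc_inner])

lemma balanced_assoc'_inner: "balanced (\<lambda>b c. (a \<otimes> b) \<otimes> c)"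
  by (simp add: balanced_def additive_def tensor_add_left tensor_add_right
      tensor_scaleC_left tensor_scaleC_right)

lemma clinear_assoc'_inner: "clinear (tensor_lift (\<lambda>b c. (a \<otimes> b) \<otimes> c))"
  by (rule clinear_tensor_lift[OF balanced_assoc'_inner])
    (simp add: tensor_scaleC_left tensor_scaleC_right)

lemma clinear_assoc'_outer: "clinear (\<lambda>a. tensor_lift (\<lambda>b c. (a \<otimes> b) \<otimes> c) t)"
proof (induction t rule: tensor_induct)
  case (pure b c)
  then show ?case
    by (simp add: clinear_iff additive_def tensor_lift_pure[OF balanced_assoc'_inner]
        tensor_add_left tensor_scaleC_left)
qed (simp_all add: clinear_iff additive_def scaleC_add_right
      additive.zero[OF additive_tensor_lift[OF balanced_assoc'_inner]]
      additive.add[OF additive_tensor_lift[OF balanced_assoc'_inner]])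

lemma balanced_assoc': "balanced (\<lambda>a t. tensor_lift (\<lambda>b c. (a \<otimes> b) \<otimes> c) t)"
  by (simp add: balanced_def clinear_assoc'_inner[unfolded clinear_iff]
      clinear_assoc'_outer[unfolded clinear_iff])

lemma assoc'_clinear: "clinear assoc'"
  unfolding assoc'_def
  by (rule clinear_tensor_lift[OF balanced_assoc']) (simp add: clinear_assoc'_outer[unfolded clinear_iff])

lemma assoc'_pure: "assoc' (a \<otimes> (b \<otimes> c)) = (a \<otimes> b) \<otimes> c"
  by (simp add: assoc'_def tensor_lift_pure[OF balanced_assoc'] tensor_lift_pure[OF balanced_assoc'_inner])

text \<open>
  \<open>mid \<sigma>\<close> is \<open>id \<otimes> \<sigma> \<otimes> id\<close>, bracketed in pairs on both sides; \<open>flip23\<close> is \<open>id \<otimes> \<tau>\<close> on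
  left-bracketed triple tensors.
\<close>

definition mid ::
  "('w::complex_vector \<otimes> 'x::complex_vector \<Rightarrow> 's::complex_vector \<otimes> 't::complex_vector) \<Rightarrow>
    ('v::complex_vector \<otimes> 'w) \<otimes> ('x \<otimes> 'y::complex_vector) \<Rightarrow> ('v \<otimes> 's) \<otimes> ('t \<otimes> 'y)"
  where "mid \<sigma> = assoc' \<circ> (id \<otimes>\<^sub>m (assoc \<circ> (\<sigma> \<otimes>\<^sub>m id) \<circ> assoc')) \<circ> assoc"

definition flip23 ::
  "('a::complex_vector \<otimes> 'b::complex_vector) \<otimes> 'c::complex_vector \<Rightarrow> ('a \<otimes> 'c) \<otimes> 'b"
  where "flip23 = assoc' \<circ> (id \<otimes>\<^sub>m flip) \<circ> assoc"


section \<open>Algebras, coalgebras and \<open>*\<close>-bialgebras\<close>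

record (overloaded) 'a bialg =
  mult :: "'a::complex_vector \<otimes> 'a \<Rightarrow> 'a"
  unit :: 'a
  comult :: "'a \<Rightarrow> 'a \<otimes> 'a"
  counit :: "'a \<Rightarrow> complex"
  star :: "'a \<Rightarrow> 'a"

locale unital_algebra =
  fixes A :: "'a::complex_vector bialg"
  assumes mult_clinear: "clinear (mult A)"
    and mult_assoc: "mult A \<circ> (mult A \<otimes>\<^sub>m id) = mult A \<circ> (id \<otimes>\<^sub>m mult A) \<circ> assoc"
    and mult_unit_left: "mult A (unit A \<otimes> a) = a"
    and mult_unit_right: "mult A (a \<otimes> unit A) = a"

locale counital_coalgebra =
  fixes A :: "'a::complex_vector bialg"
  assumes comult_clinear: "clinear (comult A)"
    and counit_clinear: "clinear (counit A)"
    and comult_coassoc: "assoc \<circ> (comult A \<otimes>\<^sub>m id) \<circ> comult A = (id \<otimes>\<^sub>m comult A) \<circ> comult A"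
    and counit_left: "lunit \<circ> (counit A \<otimes>\<^sub>m id) \<circ> comult A = id"
    and counit_right: "runit \<circ> (id \<otimes>\<^sub>m counit A) \<circ> comult A = id"

definition involution :: "('v::complex_vector \<Rightarrow> 'v) \<Rightarrow> bool"
  where "involution s \<longleftrightarrow> antilinear s \<and> s \<circ> s = id"

locale star_algebra = unital_algebra A for A :: "'a::complex_vector bialg" +
  assumes star_involution: "involution (star A)"
    and star_mult: "star A \<circ> mult A = mult A \<circ> (star A \<otimes>\<^sub>m star A) \<circ> flip"

definition algebra_hom ::
  "('a::complex_vector \<otimes> 'a \<Rightarrow> 'a) \<Rightarrow> 'a \<Rightarrow> ('b::complex_vector \<otimes> 'b \<Rightarrow> 'b) \<Rightarrow> 'b \<Rightarrow> ('a \<Rightarrow> 'b) \<Rightarrow> bool"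
  where "algebra_hom m u m' u' f \<longleftrightarrow> clinear f \<and> f \<circ> m = m' \<circ> (f \<otimes>\<^sub>m f) \<and> f u = u'"

definition tensor_mult ::
  "('b::complex_vector \<otimes> 'a::complex_vector \<Rightarrow> 'a \<otimes> 'b) \<Rightarrow> ('a \<otimes> 'a \<Rightarrow> 'a) \<Rightarrow> ('b \<otimes> 'b \<Rightarrow> 'b) \<Rightarrow>
    ('a \<otimes> 'b) \<otimes> ('a \<otimes> 'b) \<Rightarrow> 'a \<otimes> 'b"
  where "tensor_mult \<sigma> m m' = (m \<otimes>\<^sub>m m') \<circ> mid \<sigma>"

definition tensor_comult ::
  "('a::complex_vector \<Rightarrow> 'a \<otimes> 'a) \<Rightarrow> ('b::complex_vector \<Rightarrow> 'b \<otimes> 'b) \<Rightarrow>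
    'a \<otimes> 'b \<Rightarrow> ('a \<otimes> 'b) \<otimes> ('a \<otimes> 'b)"
  where "tensor_comult D D' = mid flip \<circ> (D \<otimes>\<^sub>m D')"

locale bialgebra = unital_algebra A + counital_coalgebra A for A :: "'a::complex_vector bialg" +
  assumes comult_hom: "algebra_hom (mult A) (unit A)
      (tensor_mult flip (mult A) (mult A)) (unit A \<otimes> unit A) (comult A)"
    and counit_hom: "algebra_hom (mult A) (unit A) lunit 1 (counit A)"

text \<open>
  Compatibility of the counit with the involution follows from the uniqueness of the counit, and
  \<open>S \<circ> * \<circ> S \<circ> * = id\<close> from the uniqueness of convolution inverses; neither is assumed.
\<close>

locale star_bialgebra = bialgebra A + star_algebra A for A :: "'a::complex_vector bialg" +
  assumes comult_star: "comult A \<circ> star A = (star A \<otimes>\<^sub>m star A) \<circ> comult A"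

locale hopf_star_algebra = star_bialgebra A
  for A :: "'a::complex_vector bialg" and S :: "'a \<Rightarrow> 'a" +
  assumes antipode_clinear: "clinear S"
    and antipode_left: "mult A \<circ> (S \<otimes>\<^sub>m id) \<circ> comult A = (\<lambda>a. counit A a *\<^sub>C unit A)"
    and antipode_right: "mult A \<circ> (id \<otimes>\<^sub>m S) \<circ> comult A = (\<lambda>a. counit A a *\<^sub>C unit A)"

definition convolution ::
  "('c::complex_vector \<otimes> 'd::complex_vector \<Rightarrow> 'e) \<Rightarrow> ('a::complex_vector \<Rightarrow> 'a \<otimes> 'a) \<Rightarrow>
    ('a \<Rightarrow> 'c) \<Rightarrow> ('a \<Rightarrow> 'd) \<Rightarrow> 'a \<Rightarrow> 'e"
  where "convolution m D f g = m \<circ> (f \<otimes>\<^sub>m g) \<circ> D"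

text \<open>
  Functionals are convolved with each other by \<open>lunit\<close>, the product of scalars; in a convolution
  with the product of \<open>A\<close> a functional is composed with the unit map of \<open>A\<close>.
\<close>

definition leg12 ::
  "'a::complex_vector bialg \<Rightarrow> ('a \<otimes> 'a \<Rightarrow> complex) \<Rightarrow> ('a \<otimes> 'a) \<otimes> 'a \<Rightarrow> complex"
  where "leg12 A r = lunit \<circ> (r \<otimes>\<^sub>m counit A)"

definition leg13 ::
  "'a::complex_vector bialg \<Rightarrow> ('a \<otimes> 'a \<Rightarrow> complex) \<Rightarrow> ('a \<otimes> 'a) \<otimes> 'a \<Rightarrow> complex"
  where "leg13 A r = lunit \<circ> (r \<otimes>\<^sub>m counit A) \<circ> flip23"

definition leg23 ::
  "'a::complex_vector bialg \<Rightarrow> ('a \<otimes> 'a \<Rightarrow> complex) \<Rightarrow> ('a \<otimes> 'a) \<otimes> 'a \<Rightarrow> complex"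
  where "leg23 A r = lunit \<circ> (counit A \<otimes>\<^sub>m r) \<circ> assoc"

abbreviation comult2 :: "'a::complex_vector bialg \<Rightarrow> 'a \<otimes> 'a \<Rightarrow> ('a \<otimes> 'a) \<otimes> ('a \<otimes> 'a)"
  where "comult2 A \<equiv> tensor_comult (comult A) (comult A)"

abbreviation comult3 ::
  "'a::complex_vector bialg \<Rightarrow> ('a \<otimes> 'a) \<otimes> 'a \<Rightarrow> (('a \<otimes> 'a) \<otimes> 'a) \<otimes> (('a \<otimes> 'a) \<otimes> 'a)"
  where "comult3 A \<equiv> tensor_comult (comult2 A) (comult A)"

abbreviation unit_map :: "'a::complex_vector bialg \<Rightarrow> complex \<Rightarrow> 'a"
  where "unit_map A \<equiv> \<lambda>c. c *\<^sub>C unit A"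

locale coquasitriangular_star_bialgebra = star_bialgebra A
  for A :: "'a::complex_vector bialg" and r r' :: "'a \<otimes> 'a \<Rightarrow> complex" +
  assumes r_clinear: "clinear r"
    and r'_clinear: "clinear r'"
    and r_inverse_right: "convolution lunit (comult2 A) r r' = lunit \<circ> (counit A \<otimes>\<^sub>m counit A)"
    and r_inverse_left: "convolution lunit (comult2 A) r' r = lunit \<circ> (counit A \<otimes>\<^sub>m counit A)"
    and mult_op: "mult A \<circ> flip = convolution (mult A) (comult2 A)
      (convolution (mult A) (comult2 A) (unit_map A \<circ> r) (mult A)) (unit_map A \<circ> r')"
    and r_mult_left: "r \<circ> (mult A \<otimes>\<^sub>m id) = convolution lunit (comult3 A) (leg13 A r) (leg23 A r)"
    and r_mult_right: "r \<circ> (id \<otimes>\<^sub>m mult A) \<circ> assoc =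
      convolution lunit (comult3 A) (leg13 A r) (leg12 A r)"
    and r_star: "r = cnj \<circ> r' \<circ> (star A \<otimes>\<^sub>m star A)"


section \<open>The braided category\<close>

record (overloaded) ('a, 'v) object =
  act :: "'a::complex_vector \<otimes> 'v::complex_vector \<Rightarrow> 'v"
  coact :: "'v \<Rightarrow> 'a \<otimes> 'v"
  invol :: "'v \<Rightarrow> 'v"

locale left_module =
  fixes A :: "'a::complex_vector bialg" and V :: "('a, 'v::complex_vector) object"
  assumes act_clinear: "clinear (act V)"
    and act_mult: "act V \<circ> (mult A \<otimes>\<^sub>m id) = act V \<circ> (id \<otimes>\<^sub>m act V) \<circ> assoc"
    and act_unit: "act V (unit A \<otimes> v) = v"

locale left_comodule =
  fixes A :: "'a::complex_vector bialg" and V :: "('a, 'v::complex_vector) object"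
  assumes coact_clinear: "clinear (coact V)"
    and coact_comult: "assoc \<circ> (comult A \<otimes>\<^sub>m id) \<circ> coact V = (id \<otimes>\<^sub>m coact V) \<circ> coact V"
    and coact_counit: "lunit \<circ> (counit A \<otimes>\<^sub>m id) \<circ> coact V = id"

locale star_comodule = left_comodule A V
  for A :: "'a::complex_vector bialg" and V :: "('a, 'v::complex_vector) object" +
  assumes invol_involution: "involution (invol V)"
    and coact_invol: "coact V \<circ> invol V = (star A \<otimes>\<^sub>m invol V) \<circ> coact V"

locale hopf_object = star_comodule A V + left_module A V
  for A :: "'a::complex_vector bialg" and S :: "'a \<Rightarrow> 'a" and V :: "('a, 'v::complex_vector) object" +
  assumes yetter_drinfeld: "(mult A \<otimes>\<^sub>m act V) \<circ> mid flip \<circ> (comult A \<otimes>\<^sub>m coact V) =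
      (mult A \<otimes>\<^sub>m id) \<circ> flip23 \<circ> ((coact V \<circ> act V) \<otimes>\<^sub>m id) \<circ> flip23 \<circ> (comult A \<otimes>\<^sub>m id)"
    and invol_act: "invol V (act V (a \<otimes> v)) = act V (star A (S a) \<otimes> invol V v)"

locale coquasitriangular_object = star_comodule A V
  for A :: "'a::complex_vector bialg" and r' :: "'a \<otimes> 'a \<Rightarrow> complex"
    and V :: "('a, 'v::complex_vector) object" +
  assumes act_eq: "act V = lunit \<circ> (r' \<otimes>\<^sub>m id) \<circ> assoc' \<circ> (id \<otimes>\<^sub>m coact V)"

definition morphism ::
  "('a::complex_vector, 'v::complex_vector) object \<Rightarrow> ('a, 'w::complex_vector) object \<Rightarrow> ('v \<Rightarrow> 'w) \<Rightarrow> bool"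
  where "morphism V W f \<longleftrightarrow> clinear f \<and> f \<circ> act V = act W \<circ> (id \<otimes>\<^sub>m f) \<and>
    coact W \<circ> f = (id \<otimes>\<^sub>m f) \<circ> coact V"

definition braiding ::
  "('a::complex_vector, 'v::complex_vector) object \<Rightarrow> ('a, 'w::complex_vector) object \<Rightarrow> 'v \<otimes> 'w \<Rightarrow> 'w \<otimes> 'v"
  where "braiding V W = (act W \<otimes>\<^sub>m id) \<circ> flip23 \<circ> (coact V \<otimes>\<^sub>m id)"

definition tensor_object ::
  "'a::complex_vector bialg \<Rightarrow> ('a, 'v::complex_vector) object \<Rightarrow> ('a, 'w::complex_vector) object \<Rightarrow>
    ('a, 'v \<otimes> 'w) object"
  where "tensor_object A V W =
    \<lparr>act = (act V \<otimes>\<^sub>m act W) \<circ> mid flip \<circ> (comult A \<otimes>\<^sub>m id),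
     coact = (mult A \<otimes>\<^sub>m id) \<circ> mid flip \<circ> (coact V \<otimes>\<^sub>m coact W),
     invol = braiding W V \<circ> (invol W \<otimes>\<^sub>m invol V) \<circ> flip\<rparr>"

definition unit_object :: "'a::complex_vector bialg \<Rightarrow> ('a, complex) object"
  where "unit_object A =
    \<lparr>act = lunit \<circ> (counit A \<otimes>\<^sub>m id), coact = (\<lambda>c. unit A \<otimes> c), invol = cnj\<rparr>"

text \<open>
  That \<open>V\<close> is an object depends on which of the two kinds of category is considered and is
  therefore not part of the following locale.
\<close>

locale braided_star_bialgebra = star_algebra B + counital_coalgebra B
  for A :: "'a::complex_vector bialg" and V :: "('a, 'b::complex_vector) object" and B :: "'b bialg" +
  assumes star_eq: "star B = invol V"
    and mult_morphism: "morphism (tensor_object A V V) V (mult B)"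
    and unit_morphism: "morphism (unit_object A) V (unit_map B)"
    and comult_morphism: "morphism V (tensor_object A V V) (comult B)"
    and counit_morphism: "morphism V (unit_object A) (counit B)"
    and comult_hom: "algebra_hom (mult B) (unit B)
      (tensor_mult (braiding V V) (mult B) (mult B)) (unit B \<otimes> unit B) (comult B)"
    and counit_hom: "algebra_hom (mult B) (unit B) lunit 1 (counit B)"
    and comult_star: "comult B \<circ> star B = invol (tensor_object A V V) \<circ> comult B"


section \<open>The bosonization\<close>

definition bosonization ::
  "'a::complex_vector bialg \<Rightarrow> ('a \<otimes> 'b::complex_vector \<Rightarrow> 'b) \<Rightarrow> ('b \<Rightarrow> 'a \<otimes> 'b) \<Rightarrow> 'b bialg \<Rightarrow>
    ('b \<otimes> 'a) bialg"
  where "bosonization A \<alpha> \<gamma> B =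
    \<lparr>mult = (mult B \<otimes>\<^sub>m mult A) \<circ> ((id \<otimes>\<^sub>m \<alpha>) \<otimes>\<^sub>m id) \<circ> (assoc \<otimes>\<^sub>m id) \<circ> mid flip \<circ>
       (assoc' \<otimes>\<^sub>m id) \<circ> ((id \<otimes>\<^sub>m comult A) \<otimes>\<^sub>m id),
     unit = unit B \<otimes> unit A,
     comult = assoc' \<circ> (id \<otimes>\<^sub>m (mult A \<otimes>\<^sub>m id)) \<circ> (id \<otimes>\<^sub>m mid flip) \<circ>
       (id \<otimes>\<^sub>m (\<gamma> \<otimes>\<^sub>m id)) \<circ> assoc \<circ> (comult B \<otimes>\<^sub>m comult A),
     counit = lunit \<circ> (counit B \<otimes>\<^sub>m counit A),
     star = (\<alpha> \<otimes>\<^sub>m id) \<circ> (flip \<otimes>\<^sub>m id) \<circ> assoc' \<circ> (id \<otimes>\<^sub>m comult A) \<circ> (star B \<otimes>\<^sub>m star A)\<rparr>"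

definition star_subalgebra :: "'a::complex_vector bialg \<Rightarrow> 'a set \<Rightarrow> bool"
  where "star_subalgebra H T \<longleftrightarrow> complex_vector.subspace T \<and> unit H \<in> T \<and>
    (\<forall>x\<in>T. \<forall>y\<in>T. mult H (x \<otimes> y) \<in> T) \<and> (\<forall>x\<in>T. star H x \<in> T)"

definition star_algebra_iso_onto ::
  "'a::complex_vector bialg \<Rightarrow> 'b::complex_vector bialg \<Rightarrow> ('a \<Rightarrow> 'b) \<Rightarrow> 'b set \<Rightarrow> bool"
  where "star_algebra_iso_onto B H f T \<longleftrightarrow>
    star_subalgebra H T \<and> bij_betw f UNIV T \<and>
    algebra_hom (mult B) (unit B) (mult H) (unit H) f \<and> f \<circ> star B = star H \<circ> f"

end

theory Submission
  imports Defs
begin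

text \<open>
  Both cases of the theorem enter only through the same data: an \<open>A\<close>-module and \<open>A\<close>-comodule, the
  Yetter-Drinfeld condition, and the identity \<open>a\<^sub>2 \<cdot> (a\<^sub>1\<^sup>* \<cdot> v)\<^sup>* = \<epsilon>(a) v\<^sup>*\<close>. In the Hopf case the last one
  is the antipode axiom. In the coquasi-triangular case the action by \<open>r\<close> inverts the action by
  \<open>r'\<close> up to convolution, which gives this identity and also the module axiom, and
  \<open>m\<^sup>o\<^sup>p = r \<star> m \<star> r'\<close> gives the Yetter-Drinfeld condition.

  The elements \<open>b \<otimes> 1\<close> and \<open>1 \<otimes> a\<close> generate \<open>H\<close>, with the sole mixed relation
  \<open>(1 \<otimes> a)(d \<otimes> 1) = a\<^sub>1 \<cdot> d \<otimes> a\<^sub>2\<close>, so multiplicativity of the coproduct, anti-multiplicativity of the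
  involution and their compatibility need to be checked only on these generators.
\<close>

section \<open>Sweedler notation\<close>

text \<open>In the Hopf case the involution of an object is tied to the action through
  \<open>S\<close>. The coquasi-triangular case assumes no antipode, so the shared data keep only
  the consequence that the mixed relation of \<open>H\<close> needs: the conjugated action v
  \<mapsto> \<open>invol V (act V (star A a \<otimes> invol V v))\<close> is cancelled by the
  original one, just as the action of an inverse antipode would be.

  Generators are used because on arbitrary elements multiplicativity of the coproduct involves all
  compatibility axioms at once, with many interleaved coproducts. On generators they separate: two
  elements of \<B> need the braided multiplicativity of \<open>comult B\<close> and the comodule
  structure, a mixed pair needs the Yetter-Drinfeld condition, and right multiplication by an
  element of \<A> needs only that \<open>comult A\<close> is multiplicative.\<close>

lemma tensor_sum_list: "\<exists>xs. t = (\<Sum>(x, y)\<leftarrow>xs. x \<otimes> y)"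
proof (induction t rule: tensor_induct)
  case zero
  then show ?case by (intro exI[of _ "[]"]) simp
next
  case (pure a b)
  then show ?case by (intro exI[of _ "[(a, b)]"]) simp
next
  case (add s t)
  then obtain xs ys where "s = (\<Sum>(x, y)\<leftarrow>xs. x \<otimes> y)" "t = (\<Sum>(x, y)\<leftarrow>ys. x \<otimes> y)"
    by blast
  then show ?case by (intro exI[of _ "xs @ ys"]) simp
qed

text \<open>
  \<open>sw t (\<lambda>x y. f x y)\<close> stands for \<open>f t\<^sub>(\<^sub>1\<^sub>) t\<^sub>(\<^sub>2\<^sub>)\<close>, summed over one fixed decomposition of \<open>t\<close>. Because the
  decomposition is chosen independently of \<open>f\<close>, additive maps and further sums can be moved through
  \<open>sw\<close> without any condition on \<open>f\<close>; only evaluation at a given \<open>t\<close> needs \<open>f\<close> to be bilinear.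
\<close>

definition sw ::
  "'a::complex_vector \<otimes> 'b::complex_vector \<Rightarrow> ('a \<Rightarrow> 'b \<Rightarrow> 'c::ab_group_add) \<Rightarrow> 'c"
  where "sw t f = (\<Sum>(x, y)\<leftarrow>(SOME xs. t = (\<Sum>(x, y)\<leftarrow>xs. x \<otimes> y)). f x y)"

lemma sw_tensor: "sw t (\<lambda>x y. x \<otimes> y) = t"
  unfolding sw_def using someI_ex[OF tensor_sum_list[of t]] by simp

lemma additive_sw:
  assumes "additive g"
  shows "g (sw t f) = sw t (\<lambda>x y. g (f x y))"
proof -
  have "g (\<Sum>(x, y)\<leftarrow>xs. f x y) = (\<Sum>(x, y)\<leftarrow>xs. g (f x y))" for xs
    by (induction xs) (auto simp: additive.zero[OF assms] additive.add[OF assms])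
  then show ?thesis
    by (simp add: sw_def)
qed

lemma sw_zero [simp]: "sw t (\<lambda>x y. 0) = 0"
  using additive_sw[of "\<lambda>_. 0"] by (simp add: additive_def)

lemma sw_add: "sw t (\<lambda>x y. f x y + g x y) = sw t f + sw t g"
proof -
  have "(\<Sum>(x, y)\<leftarrow>xs. f x y + g x y) = (\<Sum>(x, y)\<leftarrow>xs. f x y) + (\<Sum>(x, y)\<leftarrow>xs. g x y)" for xs
    by (induction xs) auto
  then show ?thesis
    by (simp add: sw_def)
qed

lemma sw_swap:
  "sw s (\<lambda>x y. sw t (\<lambda>u v. f x y u v)) = sw t (\<lambda>u v. sw s (\<lambda>x y. f x y u v))"
proof -
  have "(\<Sum>(x, y)\<leftarrow>xs. sw t (\<lambda>u v. f x y u v)) = sw t (\<lambda>u v. \<Sum>(x, y)\<leftarrow>xs. f x y u v)" for xs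
    by (induction xs) (auto simp: sw_add)
  then show ?thesis
    by (simp add: sw_def[of s])
qed

lemma clinear_additive: "clinear f \<Longrightarrow> additive f"
  by (simp add: clinear_iff)

lemma antilinear_additive: "antilinear f \<Longrightarrow> additive f"
  by (simp add: antilinear_def)

lemma additive_compose: "additive f \<Longrightarrow> additive g \<Longrightarrow> additive (\<lambda>x. f (g x))"
  by (simp add: additive_def)

lemmas clinear_sw = additive_sw[OF clinear_additive]
lemmas antilinear_sw = additive_sw[OF antilinear_additive]

lemma clinear_scale: "clinear f \<Longrightarrow> f (c *\<^sub>C x) = c *\<^sub>C f x"
  by (simp add: clinear_iff)

lemma antilinear_scale: "antilinear f \<Longrightarrow> f (c *\<^sub>C x) = cnj c *\<^sub>C f x"
  by (simp add: antilinear_def)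

lemma clinear_ident: "clinear (\<lambda>x. x)"
  by (simp add: clinear_iff additive_def)

lemma clinear_id: "clinear id"
  by (simp add: clinear_iff additive_def)

lemma clinear_compose: "clinear g \<Longrightarrow> clinear f \<Longrightarrow> clinear (\<lambda>x. g (f x))"
  by (simp add: clinear_iff additive_def)

lemma clinear_comp: "clinear g \<Longrightarrow> clinear f \<Longrightarrow> clinear (g \<circ> f)"
  by (simp add: clinear_iff additive_def)

lemma clinear_compose_antilinear: "antilinear g \<Longrightarrow> antilinear f \<Longrightarrow> clinear (\<lambda>x. g (f x))"
  by (simp add: clinear_iff antilinear_def additive_def)

lemma antilinear_comp: "clinear g \<Longrightarrow> antilinear f \<Longrightarrow> antilinear (g \<circ> f)"
  by (simp add: clinear_iff antilinear_def additive_def)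

lemma clinear_tensor_left: "clinear f \<Longrightarrow> clinear (\<lambda>x. f x \<otimes> z)"
  by (simp add: clinear_iff additive_def tensor_add_left tensor_scaleC_left)

lemma clinear_tensor_right: "clinear f \<Longrightarrow> clinear (\<lambda>x. z \<otimes> f x)"
  by (simp add: clinear_iff additive_def tensor_add_right tensor_scaleC_right)

lemma clinear_tensor_const: "clinear ((\<otimes>) z)"
  by (simp add: clinear_iff additive_def tensor_add_right tensor_scaleC_right)

lemma clinear_scaleC_left: "clinear f \<Longrightarrow> clinear (\<lambda>x. f x *\<^sub>C z)"
  by (simp add: clinear_iff additive_def scaleC_add_left scaleC_scaleC)

lemma clinear_scaleC_right: "clinear f \<Longrightarrow> clinear (\<lambda>x. c *\<^sub>C f x)"
  by (simp add: clinear_iff additive_def scaleC_add_right scaleC_scaleC mult.commute)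

lemma clinear_times_left: "clinear f \<Longrightarrow> clinear (\<lambda>x. f x * (z :: complex))"
  by (simp add: clinear_iff additive_def algebra_simps)

lemma clinear_times_right: "clinear f \<Longrightarrow> clinear (\<lambda>x. (z :: complex) * f x)"
  by (simp add: clinear_iff additive_def algebra_simps)

text \<open>\<open>balanced\<close> also admits maps that are antilinear in both arguments. This
  stricter condition makes \<open>sw t f\<close> linear in \<open>t\<close>, so that sums can be
  nested in the tensor argument.\<close>

definition bilin ::
  "('a::complex_vector \<Rightarrow> 'b::complex_vector \<Rightarrow> 'c::complex_vector) \<Rightarrow> bool"
  where "bilin f \<longleftrightarrow> (\<forall>y. clinear (\<lambda>x. f x y)) \<and> (\<forall>x. clinear (f x))"

lemma bilin_balanced: "bilin f \<Longrightarrow> balanced f"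
  by (simp add: bilin_def balanced_def clinear_iff)

lemma sw_eq_tensor_lift:
  assumes "bilin f"
  shows "sw t f = tensor_lift f t"
  using additive_sw[OF additive_tensor_lift[OF bilin_balanced[OF assms]], of t "(\<otimes>)"]
  by (simp add: tensor_lift_pure[OF bilin_balanced[OF assms]] sw_tensor)

lemma clinear_sw_arg:
  assumes "bilin f"
  shows "clinear (\<lambda>t. sw t f)"
  unfolding sw_eq_tensor_lift[OF assms]
  using assms by (intro clinear_tensor_lift bilin_balanced) (auto simp: bilin_def clinear_iff)

lemma clinear_sw_left: "bilin f \<Longrightarrow> clinear g \<Longrightarrow> clinear (\<lambda>x. sw (g x) f)"
  by (rule clinear_compose[OF clinear_sw_arg])

lemma scaleC_sw: "c *\<^sub>C sw t f = sw t (\<lambda>x y. c *\<^sub>C f x y)"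
  by (rule clinear_sw[OF clinear_scaleC_right[OF clinear_ident]])

lemma clinear_sw_right:
  assumes "\<And>u v. clinear (\<lambda>x. f u v x)"
  shows "clinear (\<lambda>x. sw t (\<lambda>u v. f u v x))"
  using assms by (simp add: clinear_iff additive_def sw_add scaleC_sw)

lemma sw_pure: "bilin f \<Longrightarrow> sw (a \<otimes> b) f = f a b"
  by (simp add: sw_eq_tensor_lift tensor_lift_pure bilin_balanced)

lemma sw_sw: "bilin f \<Longrightarrow> sw (sw t h) f = sw t (\<lambda>x y. sw (h x y) f)"
  by (rule clinear_sw[OF clinear_sw_arg])

lemma sw_scale: "bilin f \<Longrightarrow> sw (c *\<^sub>C t) f = c *\<^sub>C sw t f"
  by (rule clinear_scale[OF clinear_sw_arg])

lemma tensor_sw_left: "sw t f \<otimes> z = sw t (\<lambda>x y. f x y \<otimes> z)"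
  by (rule clinear_sw[OF clinear_tensor_left[OF clinear_ident]])

lemma tensor_sw_right: "z \<otimes> sw t f = sw t (\<lambda>x y. z \<otimes> f x y)"
  by (rule clinear_sw[OF clinear_tensor_right[OF clinear_ident]])

lemma scaleC_sw_left: "sw t f *\<^sub>C z = sw t (\<lambda>x y. f x y *\<^sub>C z)"
  by (rule clinear_sw[OF clinear_scaleC_left[OF clinear_ident]])

lemma times_sw_left: "sw t f * (z :: complex) = sw t (\<lambda>x y. f x y * z)"
  by (rule clinear_sw[OF clinear_times_left[OF clinear_ident]])

lemma times_sw_right: "(z :: complex) * sw t f = sw t (\<lambda>x y. z * f x y)"
  by (rule clinear_sw[OF clinear_times_right[OF clinear_ident]])

lemmas clinear_rules =
  clinear_ident clinear_id clinear_comp clinear_tensor_left clinear_tensor_right clinear_tensor_const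
  clinear_scaleC_left clinear_scaleC_right clinear_times_left clinear_times_right
  clinear_sw_left clinear_sw_right
  lunit_clinear clinear_compose[OF lunit_clinear] runit_clinear clinear_compose[OF runit_clinear]
  flip_clinear clinear_compose[OF flip_clinear] assoc_clinear clinear_compose[OF assoc_clinear]
  assoc'_clinear clinear_compose[OF assoc'_clinear] tensor_map_clinear(1)
  clinear_compose[OF tensor_map_clinear(1)]

lemma tensor_map_sw:
  "clinear f \<Longrightarrow> clinear g \<Longrightarrow> (f \<otimes>\<^sub>m g) t = sw t (\<lambda>x y. f x \<otimes> g y)"
  using clinear_sw[OF tensor_map_clinear(1), of f g t "(\<otimes>)"]
  by (simp add: tensor_map_clinear(2) sw_tensor)

lemma tensor_map_antilinear_sw:
  "antilinear f \<Longrightarrow> antilinear g \<Longrightarrow> (f \<otimes>\<^sub>m g) t = sw t (\<lambda>x y. f x \<otimes> g y)"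
  using antilinear_sw[OF tensor_map_antilinear(1), of f g t "(\<otimes>)"]
  by (simp add: tensor_map_antilinear(2) sw_tensor)

lemma flip_sw: "flip t = sw t (\<lambda>x y. y \<otimes> x)"
  using clinear_sw[OF flip_clinear, of t "(\<otimes>)"] by (simp add: flip_pure sw_tensor)

lemma lunit_sw: "lunit t = sw t (\<lambda>c x. c *\<^sub>C x)"
  using clinear_sw[OF lunit_clinear, of t "(\<otimes>)"] by (simp add: lunit_pure sw_tensor)

lemma runit_sw: "runit t = sw t (\<lambda>x c. c *\<^sub>C x)"
  using clinear_sw[OF runit_clinear, of t "(\<otimes>)"] by (simp add: runit_pure sw_tensor)

lemma assoc_sw: "assoc t = sw t (\<lambda>s z. sw s (\<lambda>x y. x \<otimes> (y \<otimes> z)))"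
proof -
  have "assoc (s \<otimes> z) = sw s (\<lambda>x y. x \<otimes> (y \<otimes> z))" for s :: "'a \<otimes> 'b" and z :: 'c
    using clinear_sw[OF clinear_compose[OF assoc_clinear clinear_tensor_left[OF clinear_ident, of z]],
        of s "(\<otimes>)"]
    by (simp add: assoc_pure sw_tensor)
  then show ?thesis
    using clinear_sw[OF assoc_clinear, of t "(\<otimes>)"] by (simp add: sw_tensor)
qed

lemma assoc'_sw: "assoc' t = sw t (\<lambda>x s. sw s (\<lambda>y z. (x \<otimes> y) \<otimes> z))"
proof -
  have "assoc' (x \<otimes> s) = sw s (\<lambda>y z. (x \<otimes> y) \<otimes> z)" for s :: "'b \<otimes> 'c" and x :: 'a
    using clinear_sw[OF clinear_compose[OF assoc'_clinear clinear_tensor_right[OF clinear_ident, of x]],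
        of s "(\<otimes>)"]
    by (simp add: assoc'_pure sw_tensor)
  then show ?thesis
    using clinear_sw[OF assoc'_clinear, of t "(\<otimes>)"] by (simp add: sw_tensor)
qed

text \<open>As a rewrite system, these rules expand a composite of structural maps into iterated
  \<open>sw\<close> over a pure tensor. The linearity side conditions of \<open>sw_pure\<close> and
  \<open>sw_sw\<close> are discharged by the same set.\<close>

lemmas sw_rules = bilin_def clinear_rules sw_pure sw_sw sw_scale scaleC_sw tensor_sw_left
  tensor_sw_right scaleC_sw_left times_sw_left times_sw_right flip_sw lunit_sw runit_sw assoc_sw
  assoc'_sw tensor_map_sw scaleC_scaleC scaleC_one

lemma mid_sw:
  assumes "clinear \<sigma>"
  shows "mid \<sigma> t =
    sw t (\<lambda>s u. sw s (\<lambda>a b. sw u (\<lambda>c d. sw (\<sigma> (b \<otimes> c)) (\<lambda>p q. (a \<otimes> p) \<otimes> (q \<otimes> d)))))"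
  by (simp add: mid_def sw_rules assms clinear_compose[OF assms] clinear_sw[OF assms])

lemma mid_flip_sw:
  "mid flip t = sw t (\<lambda>s u. sw s (\<lambda>a b. sw u (\<lambda>c d. (a \<otimes> c) \<otimes> (b \<otimes> d))))"
  by (simp add: mid_sw flip_clinear flip_pure sw_rules)

lemma flip23_sw: "flip23 t = sw t (\<lambda>s z. sw s (\<lambda>x y. (x \<otimes> z) \<otimes> y))"
  by (simp add: flip23_def sw_rules)

lemma mid_clinear: "clinear \<sigma> \<Longrightarrow> clinear (mid \<sigma>)"
  unfolding mid_def by (intro clinear_comp tensor_map_clinear assoc_clinear assoc'_clinear clinear_id)

lemma flip23_clinear: "clinear flip23"
  unfolding flip23_def
  by (intro clinear_comp tensor_map_clinear assoc_clinear assoc'_clinear clinear_id flip_clinear)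

definition trilin ::
  "('a::complex_vector \<Rightarrow> 'b::complex_vector \<Rightarrow> 'c::complex_vector \<Rightarrow> 'd::complex_vector) \<Rightarrow> bool"
  where "trilin f \<longleftrightarrow> (\<forall>y z. clinear (\<lambda>x. f x y z)) \<and> (\<forall>x z. clinear (\<lambda>y. f x y z)) \<and>
    (\<forall>x y. clinear (f x y))"

lemma clinear_tensor_eqI:
  assumes "clinear f" "clinear g" "\<And>a b. f (a \<otimes> b) = g (a \<otimes> b)"
  shows "f t = g t"
  using assms additive_eq_on_tensors[of f g] by (simp add: clinear_additive)

lemma clinear_eq_sw: "clinear f \<Longrightarrow> f t = sw t (\<lambda>x y. f (x \<otimes> y))"
  using clinear_sw[of f t "(\<otimes>)"] by (simp add: sw_tensor)

lemma sw_cong: "(\<And>x y. f x y = g x y) \<Longrightarrow> sw t f = sw t g"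
  by presburger

lemma additive_tensor_eqI:
  assumes "additive f" "additive g" "\<And>a b. f (a \<otimes> b) = g (a \<otimes> b)"
  shows "f t = g t"
  using assms additive_eq_on_tensors[of f g] by simp

lemma additive_antilinear_clinear: "antilinear g \<Longrightarrow> clinear f \<Longrightarrow> additive (\<lambda>x. g (f x))"
  by (simp add: antilinear_def clinear_iff additive_def)

lemma additive_clinear_antilinear: "clinear g \<Longrightarrow> antilinear f \<Longrightarrow> additive (\<lambda>x. g (f x))"
  by (simp add: antilinear_def clinear_iff additive_def)


section \<open>Axioms in Sweedler form\<close>

lemma algebra_hom_mult: "algebra_hom m u m' u' f \<Longrightarrow> f (m (x \<otimes> y)) = m' (f x \<otimes> f y)"
  by (auto simp: algebra_hom_def tensor_map_clinear(2) dest: fun_cong[of "f \<circ> m" _ "x \<otimes> y"])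

context unital_algebra
begin

lemmas mult_rules = mult_clinear clinear_compose[OF mult_clinear] clinear_sw[OF mult_clinear]
  clinear_scale[OF mult_clinear]

lemma mult_assoc_pure: "mult A (mult A (x \<otimes> y) \<otimes> z) = mult A (x \<otimes> mult A (y \<otimes> z))"
  using fun_cong[OF mult_assoc, of "(x \<otimes> y) \<otimes> z"]
  by (simp add: tensor_map_clinear mult_clinear clinear_id assoc_pure)

definition mult2 where "mult2 = tensor_mult flip (mult A) (mult A)"

lemma mult2_pure: "mult2 ((x \<otimes> y) \<otimes> (z \<otimes> w)) = mult A (x \<otimes> z) \<otimes> mult A (y \<otimes> w)"
  by (simp add: mult2_def tensor_mult_def mid_flip_sw sw_rules mult_rules)

lemma mult2_clinear: "clinear mult2"
  unfolding mult2_def tensor_mult_def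
  by (intro clinear_comp tensor_map_clinear mid_clinear flip_clinear mult_clinear)

lemmas mult2_rules = mult2_clinear clinear_compose[OF mult2_clinear] clinear_sw[OF mult2_clinear]
  clinear_scale[OF mult2_clinear]

text \<open>For \<open>H\<close> this allows coproducts to be regrouped after an element has been
  split into generators.\<close>

lemma mult2_assoc: "mult2 (mult2 (s \<otimes> t) \<otimes> u) = mult2 (s \<otimes> mult2 (t \<otimes> u))"
proof -
  have 1: "mult2 (mult2 ((x \<otimes> x') \<otimes> (y \<otimes> y')) \<otimes> u) = mult2 ((x \<otimes> x') \<otimes> mult2 ((y \<otimes> y') \<otimes> u))"
    for x x' y y'
    by (rule clinear_tensor_eqI[where t = u])
      (simp_all add: mult2_rules clinear_rules mult2_pure mult_assoc_pure)
  have 2: "mult2 (mult2 ((x \<otimes> x') \<otimes> t) \<otimes> u) = mult2 ((x \<otimes> x') \<otimes> mult2 (t \<otimes> u))" for x x'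
    by (rule clinear_tensor_eqI[where t = t]) (simp_all add: 1 mult2_rules clinear_rules)
  show ?thesis
    by (rule clinear_tensor_eqI[where t = s]) (simp_all add: 2 mult2_rules clinear_rules)
qed

end

context counital_coalgebra
begin

lemmas comult_rules = comult_clinear clinear_compose[OF comult_clinear] clinear_sw[OF comult_clinear]
  clinear_scale[OF comult_clinear] counit_clinear clinear_compose[OF counit_clinear]
  clinear_sw[OF counit_clinear] clinear_scale[OF counit_clinear]

text \<open>The tensor identity \<open>comult_coassoc\<close> is contracted with the linear map on
  triple tensors induced by \<open>f\<close>; trilinearity is what makes the contraction well
  defined.\<close>

lemma sw_coassoc:
  assumes "trilin f"
  shows "sw (comult A a) (\<lambda>x y. sw (comult A x) (\<lambda>u v. f u v y)) =
    sw (comult A a) (\<lambda>x y. sw (comult A y) (\<lambda>u v. f x u v))"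
  using arg_cong[OF fun_cong[OF comult_coassoc, of a], of "\<lambda>t. sw t (\<lambda>x s. sw s (\<lambda>y z. f x y z))"]
    assms
  by (simp add: trilin_def sw_rules comult_rules)

lemma sw_counit_left:
  assumes "clinear f"
  shows "sw (comult A a) (\<lambda>x y. counit A x *\<^sub>C f y) = f a"
  using arg_cong[OF fun_cong[OF counit_left, of a], of f]
  by (simp add: sw_rules comult_rules clinear_sw[OF assms] clinear_scale[OF assms])

lemma sw_counit_right:
  assumes "clinear f"
  shows "sw (comult A a) (\<lambda>x y. counit A y *\<^sub>C f x) = f a"
  using arg_cong[OF fun_cong[OF counit_right, of a], of f]
  by (simp add: sw_rules comult_rules clinear_sw[OF assms] clinear_scale[OF assms])

text \<open>Both sides sum over the fourfold coproduct of \<open>a\<close>. The right side presents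
  the two middle legs as the coproduct of a single element \<open>w\<close>, to which an identity in
  one element of \<A> can be applied.\<close>

lemma sw_coassoc_middle:
  assumes "\<And>y z w. clinear (\<lambda>x. f x y z w)" "\<And>x z w. clinear (\<lambda>y. f x y z w)"
    "\<And>x y w. clinear (\<lambda>z. f x y z w)" "\<And>x y z. clinear (f x y z)"
  shows "sw (comult A a) (\<lambda>x y. sw (comult A x) (\<lambda>x1 x2. sw (comult A y) (\<lambda>y1 y2. f x1 x2 y1 y2))) =
    sw (comult A a) (\<lambda>x1 z. sw (comult A z) (\<lambda>w y2. sw (comult A w) (\<lambda>x2 y1. f x1 x2 y1 y2)))"
proof -
  have "sw (comult A a) (\<lambda>x y. sw (comult A x) (\<lambda>x1 x2. sw (comult A y) (\<lambda>y1 y2. f x1 x2 y1 y2))) =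
    sw (comult A a) (\<lambda>x1 z. sw (comult A z) (\<lambda>x2 y. sw (comult A y) (\<lambda>y1 y2. f x1 x2 y1 y2)))"
    by (rule sw_coassoc) (simp add: trilin_def sw_rules comult_rules assms)
  also have "\<dots> = sw (comult A a) (\<lambda>x1 z. sw (comult A z) (\<lambda>w y2. sw (comult A w) (\<lambda>x2 y1.
      f x1 x2 y1 y2)))"
    by (intro sw_cong sw_coassoc[symmetric]) (simp add: trilin_def assms)
  finally show ?thesis .
qed

text \<open>This is coassociativity of the coalgebra \<open>A \<otimes> A\<close>, written out for
  the two factors in parallel.\<close>

lemma sw_coassoc2:
  assumes "\<And>x2 y z1 z2 w. clinear (\<lambda>x1. f x1 x2 y z1 z2 w)"
    "\<And>x1 y z1 z2 w. clinear (\<lambda>x2. f x1 x2 y z1 z2 w)"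
    "\<And>x1 x2 z1 z2 w. clinear (\<lambda>y. f x1 x2 y z1 z2 w)"
    "\<And>x1 x2 y z2 w. clinear (\<lambda>z1. f x1 x2 y z1 z2 w)"
    "\<And>x1 x2 y z1 w. clinear (\<lambda>z2. f x1 x2 y z1 z2 w)"
    "\<And>x1 x2 y z1 z2. clinear (f x1 x2 y z1 z2)"
  shows "sw (comult A a) (\<lambda>x y. sw (comult A b) (\<lambda>z w. sw (comult A x) (\<lambda>x1 x2.
      sw (comult A z) (\<lambda>z1 z2. f x1 x2 y z1 z2 w)))) =
    sw (comult A a) (\<lambda>x y. sw (comult A b) (\<lambda>z w. sw (comult A y) (\<lambda>y1 y2.
      sw (comult A w) (\<lambda>w1 w2. f x y1 y2 z w1 w2))))"
proof -
  have "sw (comult A a) (\<lambda>x y. sw (comult A b) (\<lambda>z w. sw (comult A x) (\<lambda>x1 x2.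
        sw (comult A z) (\<lambda>z1 z2. f x1 x2 y z1 z2 w)))) =
      sw (comult A a) (\<lambda>x y. sw (comult A x) (\<lambda>x1 x2. sw (comult A b) (\<lambda>z w.
        sw (comult A z) (\<lambda>z1 z2. f x1 x2 y z1 z2 w))))"
    by (simp add: sw_swap[of "comult A b"])
  also have "\<dots> = sw (comult A a) (\<lambda>x y. sw (comult A y) (\<lambda>y1 y2. sw (comult A b) (\<lambda>z w.
        sw (comult A z) (\<lambda>z1 z2. f x y1 y2 z1 z2 w))))"
    by (rule sw_coassoc) (simp add: trilin_def sw_rules comult_rules assms)
  also have "\<dots> = sw (comult A a) (\<lambda>x y. sw (comult A y) (\<lambda>y1 y2. sw (comult A b) (\<lambda>z w.
        sw (comult A w) (\<lambda>w1 w2. f x y1 y2 z w1 w2))))"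
    by (intro sw_cong sw_coassoc) (simp add: trilin_def assms)
  also have "\<dots> = sw (comult A a) (\<lambda>x y. sw (comult A b) (\<lambda>z w. sw (comult A y) (\<lambda>y1 y2.
        sw (comult A w) (\<lambda>w1 w2. f x y1 y2 z w1 w2))))"
    by (intro sw_cong sw_swap)
  finally show ?thesis .
qed

end

context star_algebra
begin

lemma star_antilinear: "antilinear (star A)"
  using star_involution by (simp add: involution_def)

lemma star_star: "star A (star A a) = a"
  using star_involution by (simp add: involution_def fun_eq_iff)

lemma star_mult_pure: "star A (mult A (x \<otimes> y)) = mult A (star A y \<otimes> star A x)"
  using fun_cong[OF star_mult, of "x \<otimes> y"]
  by (simp add: flip_pure tensor_map_antilinear star_antilinear)

lemma star_unit: "star A (unit A) = unit A"
  using star_mult_pure[of "star A (unit A)" "unit A"]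
  by (simp add: mult_unit_right mult_unit_left star_star)

lemmas star_rules = antilinear_sw[OF star_antilinear] antilinear_scale[OF star_antilinear]

lemma star_mult2:
  "(star A \<otimes>\<^sub>m star A) (mult2 (s \<otimes> t)) = mult2 ((star A \<otimes>\<^sub>m star A) t \<otimes> (star A \<otimes>\<^sub>m star A) s)"
proof -
  let ?s = "star A \<otimes>\<^sub>m star A"
  have s: "antilinear ?s"
    by (intro tensor_map_antilinear star_antilinear)
  note add = additive_antilinear_clinear[OF s]
    additive_clinear_antilinear[OF _ s, where g = "\<lambda>z. mult2 (z \<otimes> w)" for w]
    additive_clinear_antilinear[OF _ s, where g = "\<lambda>z. mult2 (w \<otimes> z)" for w]
  have 1: "?s (mult2 ((x \<otimes> x') \<otimes> t)) = mult2 (?s t \<otimes> ?s (x \<otimes> x'))" for x x'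
    by (rule additive_tensor_eqI[where t = t])
      (simp_all add: add mult2_rules clinear_rules mult2_pure tensor_map_antilinear(2)
        star_antilinear star_mult_pure)
  show ?thesis
    by (rule additive_tensor_eqI[where t = s]) (simp_all add: add 1 mult2_rules clinear_rules)
qed

end

context bialgebra
begin

lemma counit_mult: "counit A (mult A (x \<otimes> y)) = counit A x * counit A y"
  by (simp add: algebra_hom_mult[OF counit_hom] lunit_pure)

lemma counit_unit: "counit A (unit A) = 1"
  using counit_hom by (simp add: algebra_hom_def)

lemma sw_comult_mult:
  assumes "bilin f"
  shows "sw (comult A (mult A (a \<otimes> b))) f =
    sw (comult A a) (\<lambda>a1 a2. sw (comult A b) (\<lambda>b1 b2. f (mult A (a1 \<otimes> b1)) (mult A (a2 \<otimes> b2))))"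
  using assms
  by (simp add: algebra_hom_mult[OF comult_hom] tensor_mult_def mid_flip_sw sw_rules comult_rules
      mult_rules)

lemma sw_comult_unit: "bilin f \<Longrightarrow> sw (comult A (unit A)) f = f (unit A) (unit A)"
  using comult_hom by (simp add: algebra_hom_def sw_pure)

end

context star_bialgebra
begin

lemma sw_comult_star:
  assumes "bilin f"
  shows "sw (comult A (star A a)) f = sw (comult A a) (\<lambda>x y. f (star A x) (star A y))"
  using fun_cong[OF comult_star, of a] assms
  by (simp add: tensor_map_antilinear_sw star_antilinear sw_sw sw_pure)

text \<open>Since the star commutes with the coproduct, \<open>?e\<close> is again a left counit.
  Applying \<open>counit A\<close> to that law leaves \<open>?e\<close> on the first leg and
  \<open>counit A\<close> on the second, and the right counit law evaluates the sum to
  \<open>?e a\<close>; hence the two functionals agree.\<close>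

lemma counit_star: "counit A (star A a) = cnj (counit A a)"
proof -
  let ?e = "\<lambda>x. cnj (counit A (star A x))"
  have "antilinear cnj"
    by (simp add: antilinear_def additive_def)
  then have e: "clinear ?e"
    using clinear_compose_antilinear[of cnj "\<lambda>x. counit A (star A x)"]
      antilinear_comp[OF counit_clinear star_antilinear] by (simp add: comp_def)
  have bil: "bilin (\<lambda>x y. counit A x *\<^sub>C y)"
    by (simp add: sw_rules comult_rules)
  have "star A (sw (comult A a) (\<lambda>x y. counit A (star A x) *\<^sub>C star A y)) = a"
    using sw_counit_left[OF clinear_ident, of "star A a"]
    by (simp add: sw_comult_star[OF bil] star_star)
  then have "sw (comult A a) (\<lambda>x y. ?e x *\<^sub>C y) = a"
    by (simp add: star_rules star_star)
  from arg_cong[OF this, of "counit A"]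
  have "sw (comult A a) (\<lambda>x y. counit A y *\<^sub>C ?e x) = counit A a"
    by (simp add: comult_rules mult.commute)
  then have "?e a = counit A a"
    by (simp add: sw_counit_right[OF e] del: scaleC_complex_def)
  then show ?thesis
    by (metis complex_cnj_cnj)
qed

end

context left_module
begin

lemmas act_rules = act_clinear clinear_compose[OF act_clinear] clinear_sw[OF act_clinear]
  clinear_scale[OF act_clinear]

lemma act_mult_pure:
  assumes "clinear (mult A)"
  shows "act V (mult A (a \<otimes> b) \<otimes> v) = act V (a \<otimes> act V (b \<otimes> v))"
  using fun_cong[OF act_mult, of "(a \<otimes> b) \<otimes> v"] assms
  by (simp add: tensor_map_clinear act_clinear clinear_id assoc_pure)

end

context left_comodule
begin

lemmas coact_rules = coact_clinear clinear_compose[OF coact_clinear] clinear_sw[OF coact_clinear]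
  clinear_scale[OF coact_clinear]

lemma sw_coact_comult:
  assumes "trilin f" "clinear (comult A)"
  shows "sw (coact V v) (\<lambda>p q. sw (comult A p) (\<lambda>s t. f s t q)) =
    sw (coact V v) (\<lambda>p q. sw (coact V q) (\<lambda>s t. f p s t))"
  using arg_cong[OF fun_cong[OF coact_comult, of v], of "\<lambda>t. sw t (\<lambda>x s. sw s (\<lambda>y z. f x y z))"]
    assms
  by (simp add: trilin_def sw_rules coact_rules)

lemma sw_coact_counit:
  assumes "clinear f" "clinear (counit A)"
  shows "sw (coact V v) (\<lambda>p q. counit A p *\<^sub>C f q) = f v"
  using arg_cong[OF fun_cong[OF coact_counit, of v], of f] assms(2)
  by (simp add: sw_rules coact_rules clinear_sw[OF assms(1)] clinear_scale[OF assms(1)])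

end

context star_comodule
begin

lemma invol_antilinear: "antilinear (invol V)"
  using invol_involution by (simp add: involution_def)

lemma sw_coact_invol:
  assumes "bilin f" "antilinear (star A)"
  shows "sw (coact V (invol V v)) f = sw (coact V v) (\<lambda>p q. f (star A p) (invol V q))"
  using fun_cong[OF coact_invol, of v] assms
  by (simp add: tensor_map_antilinear_sw invol_antilinear sw_sw sw_pure)

end


section \<open>The bosonization\<close>

lemma morphism_act: "morphism V W f \<Longrightarrow> f (act V t) = act W ((id \<otimes>\<^sub>m f) t)"
  by (auto simp: morphism_def dest: fun_cong[of "f \<circ> act V" _ t])

lemma morphism_coact: "morphism V W f \<Longrightarrow> coact W (f v) = (id \<otimes>\<^sub>m f) (coact V v)"
  by (auto simp: morphism_def dest: fun_cong[of "coact W \<circ> f" _ v])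

locale bosonization_data = A: star_bialgebra A + left_module A V + star_comodule A V +
  B: braided_star_bialgebra A V B
  for A :: "'a::complex_vector bialg" and V :: "('a, 'b::complex_vector) object" and B :: "'b bialg" +
  assumes yetter_drinfeld_tensor:
    "sw (comult A a) (\<lambda>x y. sw (coact V v) (\<lambda>p q. mult A (x \<otimes> p) \<otimes> act V (y \<otimes> q))) =
      sw (comult A a) (\<lambda>x y. sw (coact V (act V (x \<otimes> v))) (\<lambda>p q. mult A (p \<otimes> y) \<otimes> q))"
    and act_invol_cancel:
    "sw (comult A a) (\<lambda>x y. act V (y \<otimes> invol V (act V (star A x \<otimes> v)))) = counit A a *\<^sub>C invol V v"
begin

abbreviation amult (infixl "\<cdot>" 85) where "x \<cdot> y \<equiv> mult A (x \<otimes> y)"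
abbreviation bmult (infixl "\<bullet>" 85) where "x \<bullet> y \<equiv> mult B (x \<otimes> y)"
abbreviation action (infixr "\<rhd>" 90) where "x \<rhd> v \<equiv> act V (x \<otimes> v)"

lemmas lin_rules = sw_rules A.mult_rules A.comult_rules B.mult_rules B.comult_rules
  act_rules coact_rules flip23_clinear mid_clinear

section \<open>Compatibility of the action and coaction with the structure of
  \<open>B\<close>\<close>

lemma sw_yetter_drinfeld:
  assumes "bilin f"
  shows "sw (comult A a) (\<lambda>x y. sw (coact V (x \<rhd> v)) (\<lambda>p q. f (p \<cdot> y) q)) =
    sw (comult A a) (\<lambda>x y. sw (coact V v) (\<lambda>p q. f (x \<cdot> p) (y \<rhd> q)))"
  using arg_cong[OF yetter_drinfeld_tensor[of a v], of "\<lambda>t. sw t f"] assms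
  by (simp add: lin_rules)

lemma act_assoc: "(x \<cdot> y) \<rhd> v = x \<rhd> y \<rhd> v"
  by (rule act_mult_pure[OF A.mult_clinear])

lemma act_bmult: "x \<rhd> (b \<bullet> d) = sw (comult A x) (\<lambda>u v. (u \<rhd> b) \<bullet> (v \<rhd> d))"
  using morphism_act[OF B.mult_morphism, of "x \<otimes> (b \<otimes> d)"]
  by (simp add: trilin_def tensor_object_def unit_object_def mid_flip_sw lin_rules)

lemma act_bunit: "x \<rhd> unit B = counit A x *\<^sub>C unit B"
  using morphism_act[OF B.unit_morphism, of "x \<otimes> 1"]
  by (simp add: trilin_def tensor_object_def unit_object_def mid_flip_sw lin_rules)

lemma sw_coact_bmult:
  assumes "bilin f"
  shows "sw (coact V (b \<bullet> d)) f =
    sw (coact V b) (\<lambda>p q. sw (coact V d) (\<lambda>s t. f (p \<cdot> s) (q \<bullet> t)))"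
  using morphism_coact[OF B.mult_morphism, of "b \<otimes> d"] assms
  by (simp add: trilin_def tensor_object_def unit_object_def mid_flip_sw lin_rules)

lemma sw_coact_bunit: "bilin f \<Longrightarrow> sw (coact V (unit B)) f = f (unit A) (unit B)"
  using morphism_coact[OF B.unit_morphism, of "1"]
  by (simp add: trilin_def tensor_object_def unit_object_def mid_flip_sw lin_rules)

lemma sw_bcomult_act:
  assumes "bilin f"
  shows "sw (comult B (x \<rhd> b)) f =
    sw (comult A x) (\<lambda>u v. sw (comult B b) (\<lambda>b1 b2. f (u \<rhd> b1) (v \<rhd> b2)))"
  using morphism_act[OF B.comult_morphism, of "x \<otimes> b"] assms
  by (simp add: trilin_def tensor_object_def unit_object_def mid_flip_sw lin_rules)

lemma sw_coact_bcomult: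
  assumes "trilin f"
  shows "sw (coact V b) (\<lambda>p q. sw (comult B q) (\<lambda>u v. f p u v)) =
    sw (comult B b) (\<lambda>b1 b2. sw (coact V b1) (\<lambda>p q. sw (coact V b2) (\<lambda>s t. f (p \<cdot> s) q t)))"
  using arg_cong[OF morphism_coact[OF B.comult_morphism, of b],
      of "\<lambda>t. sw t (\<lambda>x s. sw s (\<lambda>y z. f x y z))"] assms
  by (simp add: trilin_def tensor_object_def mid_flip_sw lin_rules)

lemma bcounit_act: "counit B (x \<rhd> b) = counit A x * counit B b"
  using morphism_act[OF B.counit_morphism, of "x \<otimes> b"]
  by (simp add: trilin_def tensor_object_def unit_object_def mid_flip_sw lin_rules)

lemma sw_coact_bcounit:
  assumes "clinear f"
  shows "sw (coact V b) (\<lambda>p q. counit B q *\<^sub>C f p) = counit B b *\<^sub>C f (unit A)"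
  using arg_cong[OF morphism_coact[OF B.counit_morphism, of b], of "\<lambda>t. sw t (\<lambda>x s. s *\<^sub>C f x)"]
    assms
  by (simp add: unit_object_def lin_rules clinear_compose[OF assms])

lemma sw_bcomult_bmult:
  assumes "bilin f"
  shows "sw (comult B (b \<bullet> d)) f =
    sw (comult B b) (\<lambda>b1 b2. sw (comult B d) (\<lambda>d1 d2. sw (coact V b2) (\<lambda>p q.
      f (b1 \<bullet> (p \<rhd> d1)) (q \<bullet> d2))))"
  using assms
  by (simp add: algebra_hom_mult[OF B.comult_hom] tensor_mult_def mid_sw braiding_def flip23_sw lin_rules)

lemma sw_bcomult_bunit: "bilin f \<Longrightarrow> sw (comult B (unit B)) f = f (unit B) (unit B)"
  using B.comult_hom by (simp add: algebra_hom_def sw_pure)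

lemma bcounit_bmult: "counit B (b \<bullet> d) = counit B b * counit B d"
  by (simp add: algebra_hom_mult[OF B.counit_hom] lunit_pure)

lemma bcounit_bunit: "counit B (unit B) = 1"
  using B.counit_hom by (simp add: algebra_hom_def)

lemmas binvol_star = B.star_star[unfolded B.star_eq]
lemmas binvol_bmult = B.star_mult_pure[unfolded B.star_eq]
lemmas binvol_bunit = B.star_unit[unfolded B.star_eq]
lemmas sw_coact_star = sw_coact_invol[OF _ A.star_antilinear]

text \<open>The involution on \<open>B \<otimes> B\<close> flips the legs and the braiding flips
  them back. What remains of the braiding is the action of the coaction leg of the second factor on
  the first.\<close>

lemma sw_bcomult_star:
  assumes "bilin f"
  shows "sw (comult B (invol V b)) f =
    sw (comult B b) (\<lambda>b1 b2. sw (coact V b2) (\<lambda>p q. f (star A p \<rhd> invol V b1) (invol V q)))"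
  using fun_cong[OF B.comult_star[unfolded B.star_eq], of b] assms
  by (simp add: tensor_object_def braiding_def flip23_sw sw_coact_star lin_rules
      antilinear_sw[OF tensor_map_antilinear(1)[OF invol_antilinear invol_antilinear]]
      tensor_map_antilinear(2)[OF invol_antilinear invol_antilinear])

section \<open>The algebra and the coalgebra \<open>H\<close>\<close>

definition H where "H = bosonization A (act V) (coact V) B"

lemma H_mult_pure: "mult H ((b \<otimes> a) \<otimes> (d \<otimes> c)) = sw (comult A a) (\<lambda>x y. b \<bullet> (x \<rhd> d) \<otimes> y \<cdot> c)"
  by (simp add: H_def bosonization_def mid_flip_sw lin_rules)

lemma H_unit: "unit H = unit B \<otimes> unit A"
  by (simp add: H_def bosonization_def)

lemma H_comult_pure:
  "comult H (b \<otimes> a) = sw (comult B b) (\<lambda>b1 b2. sw (coact V b2) (\<lambda>p q. sw (comult A a) (\<lambda>a1 a2.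
    (b1 \<otimes> p \<cdot> a1) \<otimes> (q \<otimes> a2))))"
  by (simp add: H_def bosonization_def mid_flip_sw lin_rules)

lemma H_counit_pure: "counit H (b \<otimes> a) = counit B b * counit A a"
  by (simp add: H_def bosonization_def lin_rules)

lemma H_star_pure: "star H (b \<otimes> a) = sw (comult A (star A a)) (\<lambda>x y. (x \<rhd> invol V b) \<otimes> y)"
  by (simp add: H_def bosonization_def tensor_map_antilinear B.star_antilinear A.star_antilinear
      lin_rules B.star_eq invol_antilinear)

lemma H_clinear: "clinear (mult H)" "clinear (comult H)" "clinear (counit H)"
  by (simp_all add: H_def bosonization_def lin_rules mid_clinear)

lemma H_star_antilinear: "antilinear (star H)"
  unfolding H_def bosonization_def
  by (simp, intro antilinear_comp tensor_map_antilinear B.star_antilinear A.star_antilinear)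
    (simp_all add: lin_rules)

lemmas H_rules = H_clinear clinear_compose[OF H_clinear(1)] clinear_compose[OF H_clinear(2)]
  clinear_compose[OF H_clinear(3)] clinear_sw[OF H_clinear(1)] clinear_sw[OF H_clinear(2)]
  clinear_sw[OF H_clinear(3)] clinear_scale[OF H_clinear(1)] clinear_scale[OF H_clinear(2)]
  clinear_scale[OF H_clinear(3)]

text \<open>These orient \<open>sw_swap\<close> towards a normal order of independent sums:
  \<open>comult B\<close> outermost, then \<open>coact V\<close>, then \<open>comult A\<close>. No
  rule undoes another, so rewriting does not loop.\<close>

lemmas sw_order = sw_swap[of "comult A x" "comult B y" for x y] sw_swap[of "comult A x" "coact V y" for x y]
  sw_swap[of "coact V x" "comult B y" for x y]

text \<open>Both bracketings spread three legs of \<open>a\<close> over the product. One obtains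
  them by splitting the second leg when \<open>comult A\<close> meets a product, the other by
  splitting the first leg when \<open>a\<close> acts on a product in \<open>B\<close>;
  coassociativity identifies the two.\<close>

lemma H_mult_assoc: "mult H (mult H (s \<otimes> t) \<otimes> u) = mult H (s \<otimes> mult H (t \<otimes> u))"
proof -
  have 1: "mult H (mult H ((b \<otimes> a) \<otimes> (d \<otimes> c)) \<otimes> (f \<otimes> e)) =
      mult H ((b \<otimes> a) \<otimes> mult H ((d \<otimes> c) \<otimes> (f \<otimes> e)))" (is "?l = ?r") for b a d c f e
  proof -
    have "?l = sw (comult A a) (\<lambda>x y. sw (comult A y) (\<lambda>u v. sw (comult A c) (\<lambda>s t.
        b \<bullet> ((x \<rhd> d) \<bullet> (u \<rhd> s \<rhd> f)) \<otimes> v \<cdot> (t \<cdot> e))))"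
      by (simp add: H_mult_pure H_rules lin_rules A.sw_comult_mult A.mult_assoc_pure
          B.mult_assoc_pure act_assoc)
    also have "\<dots> = sw (comult A a) (\<lambda>x y. sw (comult A x) (\<lambda>u v. sw (comult A c) (\<lambda>s t.
        b \<bullet> ((u \<rhd> d) \<bullet> (v \<rhd> s \<rhd> f)) \<otimes> y \<cdot> (t \<cdot> e))))"
      by (rule A.sw_coassoc[symmetric]) (simp add: trilin_def lin_rules)
    also have "\<dots> = ?r"
      by (simp add: H_mult_pure H_rules lin_rules act_bmult sw_swap[of "comult A c"])
    finally show ?thesis .
  qed
  have 2: "mult H (mult H ((b \<otimes> a) \<otimes> (d \<otimes> c)) \<otimes> u) =
      mult H ((b \<otimes> a) \<otimes> mult H ((d \<otimes> c) \<otimes> u))" for b a d c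
    by (rule clinear_tensor_eqI[where t = u]) (simp_all add: 1 H_rules lin_rules)
  have 3: "mult H (mult H ((b \<otimes> a) \<otimes> t) \<otimes> u) = mult H ((b \<otimes> a) \<otimes> mult H (t \<otimes> u))" for b a
    by (rule clinear_tensor_eqI[where t = t]) (simp_all add: 2 H_rules lin_rules)
  show ?thesis
    by (rule clinear_tensor_eqI[where t = s]) (simp_all add: 3 H_rules lin_rules)
qed

lemma H_unital_algebra: "unital_algebra H"
proof (rule unital_algebra.intro)
  show "clinear (mult H)" by (rule H_clinear)
  show "mult H \<circ> (mult H \<otimes>\<^sub>m id) = mult H \<circ> (id \<otimes>\<^sub>m mult H) \<circ> assoc"
  proof (rule additive_eq_on_tensors)
    fix t u
    \<comment> \<open>The first factor \<open>t\<close> is itself an arbitrary tensor over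
      \<open>H\<close>, so it has to be decomposed once more.\<close>
    have "mult H t = sw t (\<lambda>x y. mult H (x \<otimes> y))"
      by (rule clinear_eq_sw[OF H_clinear(1)])
    then show "(mult H \<circ> (mult H \<otimes>\<^sub>m id)) (t \<otimes> u) = (mult H \<circ> (id \<otimes>\<^sub>m mult H) \<circ> assoc) (t \<otimes> u)"
      by (simp add: H_rules lin_rules H_mult_assoc)
  qed (intro clinear_additive clinear_comp tensor_map_clinear H_clinear clinear_id assoc_clinear)+
  show "mult H (unit H \<otimes> x) = x" for x
    by (rule clinear_tensor_eqI[where t = x])
      (simp_all add: H_unit H_rules lin_rules H_mult_pure A.sw_comult_unit act_unit
        A.mult_unit_left B.mult_unit_left)
  show "mult H (x \<otimes> unit H) = x" for x
  proof -
    have 1: "sw (comult A a) (\<lambda>x y. counit A x *\<^sub>C (b \<otimes> y)) = b \<otimes> a" for b a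
      by (rule A.sw_counit_left) (simp add: lin_rules)
    show ?thesis
      by (rule clinear_tensor_eqI[where t = x])
        (simp_all add: 1 H_unit H_rules lin_rules H_mult_pure act_bunit tensor_scaleC_left tensor_scaleC_right
          A.mult_unit_right B.mult_unit_right)
  qed
qed

lemma H_comult_coassoc_pure:
  "assoc ((comult H \<otimes>\<^sub>m id) (comult H (b \<otimes> a))) = (id \<otimes>\<^sub>m comult H) (comult H (b \<otimes> a))"
  (is "?l = ?r")
proof -
  \<comment> \<open>The common summand: \<open>s\<close>, \<open>t\<close> come from the coaction on
    the second leg of \<open>b\<close>; \<open>p1\<close>, \<open>p2\<close>, \<open>q\<close> from
    the coaction on the third leg, with its \<A>-part split in two.\<close>
  let ?F = "\<lambda>b1 s t p1 p2 q a1 a2 a3. (b1 \<otimes> s \<cdot> (p1 \<cdot> a1)) \<otimes> ((t \<otimes> p2 \<cdot> a2) \<otimes> (q \<otimes> a3))"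
  have "?r = sw (comult B b) (\<lambda>b1 x. sw (coact V x) (\<lambda>p r. sw (comult B r) (\<lambda>q1 q2.
      sw (coact V q2) (\<lambda>u v. sw (comult A a) (\<lambda>a1 z. sw (comult A z) (\<lambda>a2 a3.
        (b1 \<otimes> p \<cdot> a1) \<otimes> ((q1 \<otimes> u \<cdot> a2) \<otimes> (v \<otimes> a3))))))))"
    by (simp add: H_comult_pure H_rules lin_rules sw_order)
  also have "\<dots> = sw (comult B b) (\<lambda>b1 x. sw (comult B x) (\<lambda>b2 b3. sw (coact V b2) (\<lambda>s t.
      sw (coact V b3) (\<lambda>p r. sw (coact V r) (\<lambda>u q. sw (comult A a) (\<lambda>a1 z. sw (comult A z) (\<lambda>a2 a3.
        ?F b1 s t p u q a1 a2 a3)))))))"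
    by (simp add: sw_coact_bcomult trilin_def lin_rules A.mult_assoc_pure)
  also have "\<dots> = sw (comult B b) (\<lambda>b1 x. sw (comult B x) (\<lambda>b2 b3. sw (coact V b2) (\<lambda>s t.
      sw (coact V b3) (\<lambda>p q. sw (comult A p) (\<lambda>p1 p2. sw (comult A a) (\<lambda>a1 z. sw (comult A z) (\<lambda>a2 a3.
        ?F b1 s t p1 p2 q a1 a2 a3)))))))"
    by (intro sw_cong sw_coact_comult[symmetric]) (simp_all add: trilin_def lin_rules)
  also have "\<dots> = sw (comult B b) (\<lambda>b1 x. sw (comult B x) (\<lambda>b2 b3. sw (coact V b3) (\<lambda>p q.
      sw (coact V b2) (\<lambda>s t. sw (comult A p) (\<lambda>p1 p2. sw (comult A a) (\<lambda>a1 z. sw (comult A z) (\<lambda>a2 a3.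
        ?F b1 s t p1 p2 q a1 a2 a3)))))))"
    by (intro sw_cong sw_swap)
  also have "\<dots> = sw (comult B b) (\<lambda>x b3. sw (comult B x) (\<lambda>b1 b2. sw (coact V b3) (\<lambda>p q.
      sw (coact V b2) (\<lambda>s t. sw (comult A p) (\<lambda>p1 p2. sw (comult A a) (\<lambda>a1 z. sw (comult A z) (\<lambda>a2 a3.
        ?F b1 s t p1 p2 q a1 a2 a3)))))))"
    by (rule B.sw_coassoc[symmetric]) (simp add: trilin_def lin_rules)
  also have "\<dots> = sw (comult B b) (\<lambda>x b3. sw (comult B x) (\<lambda>b1 b2. sw (coact V b3) (\<lambda>p q.
      sw (coact V b2) (\<lambda>s t. sw (comult A p) (\<lambda>p1 p2. sw (comult A a) (\<lambda>z a3. sw (comult A z) (\<lambda>a1 a2.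
        ?F b1 s t p1 p2 q a1 a2 a3)))))))"
    by (intro sw_cong A.sw_coassoc[symmetric]) (simp_all add: trilin_def lin_rules)
  also have "\<dots> = ?l"
    by (simp add: H_comult_pure H_rules lin_rules A.sw_comult_mult A.mult_assoc_pure sw_order
        sw_swap[of "comult A a"])
  finally show ?thesis ..
qed

lemma H_counital_coalgebra: "counital_coalgebra H"
proof (rule counital_coalgebra.intro)
  show "clinear (comult H)" "clinear (counit H)" by (rule H_clinear)+
  show "assoc \<circ> (comult H \<otimes>\<^sub>m id) \<circ> comult H = (id \<otimes>\<^sub>m comult H) \<circ> comult H"
    by (rule additive_eq_on_tensors)
      (simp_all add: H_comult_coassoc_pure clinear_additive H_rules clinear_rules)
  have "lunit ((counit H \<otimes>\<^sub>m id) (comult H (b \<otimes> a))) = b \<otimes> a" for b a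
  proof -
    have "lunit ((counit H \<otimes>\<^sub>m id) (comult H (b \<otimes> a))) =
       sw (comult B b) (\<lambda>b1 b2. counit B b1 *\<^sub>C sw (coact V b2) (\<lambda>p q. counit A p *\<^sub>C
         sw (comult A a) (\<lambda>a1 a2. counit A a1 *\<^sub>C (q \<otimes> a2))))"
      by (simp add: H_comult_pure H_counit_pure A.counit_mult H_rules lin_rules)
    \<comment> \<open>The scalars must stay in front of the inner sums for the counit laws to match;
      \<open>scaleC_sw\<close> would push them back inside.\<close>
    also have "\<dots> = b \<otimes> a"
      by (simp add: A.sw_counit_left B.sw_counit_left sw_coact_counit lin_rules del: scaleC_sw scaleC_scaleC)
    finally show ?thesis .
  qed
  then show "lunit \<circ> (counit H \<otimes>\<^sub>m id) \<circ> comult H = id"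
    by (intro additive_eq_on_tensors) (simp_all add: clinear_additive H_rules clinear_rules)
  have "runit ((id \<otimes>\<^sub>m counit H) (comult H (b \<otimes> a))) = b \<otimes> a" for b a
  proof -
    have "runit ((id \<otimes>\<^sub>m counit H) (comult H (b \<otimes> a))) =
       sw (comult B b) (\<lambda>b1 b2. sw (coact V b2) (\<lambda>p q. counit B q *\<^sub>C
         sw (comult A a) (\<lambda>a1 a2. counit A a2 *\<^sub>C (b1 \<otimes> p \<cdot> a1))))"
      by (simp add: H_comult_pure H_counit_pure H_rules lin_rules)
    also have "\<dots> = b \<otimes> a"
      by (simp add: A.sw_counit_right B.sw_counit_right sw_coact_bcounit A.mult_unit_left lin_rules
          del: scaleC_sw scaleC_scaleC)
    finally show ?thesis .
  qed
  then show "runit \<circ> (id \<otimes>\<^sub>m counit H) \<circ> comult H = id"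
    by (intro additive_eq_on_tensors) (simp_all add: clinear_additive H_rules clinear_rules)
qed

section \<open>Generators of \<open>H\<close> and multiplicativity of its coproduct and
  counit\<close>

lemma H_mult_right: "mult H ((b \<otimes> a) \<otimes> (unit B \<otimes> c)) = b \<otimes> a \<cdot> c"
  using A.sw_counit_left[of "\<lambda>y. b \<otimes> y \<cdot> c" a]
  by (simp add: H_mult_pure act_bunit B.mult_unit_right lin_rules tensor_scaleC_left tensor_scaleC_right)

lemma H_mult_left: "mult H ((b \<otimes> unit A) \<otimes> (d \<otimes> c)) = b \<bullet> d \<otimes> c"
  by (simp add: H_mult_pure A.sw_comult_unit act_unit A.mult_unit_left lin_rules)

lemma H_mult_mixed:
  "mult H ((unit B \<otimes> a) \<otimes> (d \<otimes> unit A)) = sw (comult A a) (\<lambda>x y. (x \<rhd> d) \<otimes> y)"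
  by (simp add: H_mult_pure B.mult_unit_left A.mult_unit_right)

lemma H_comult_A: "comult H (unit B \<otimes> a) = sw (comult A a) (\<lambda>x y. (unit B \<otimes> x) \<otimes> (unit B \<otimes> y))"
  by (simp add: H_comult_pure sw_bcomult_bunit sw_coact_bunit A.mult_unit_left lin_rules)

lemma H_comult_B:
  "comult H (b \<otimes> unit A) = sw (comult B b) (\<lambda>b1 b2. sw (coact V b2) (\<lambda>p q.
    (b1 \<otimes> p) \<otimes> (q \<otimes> unit A)))"
  by (simp add: H_comult_pure A.sw_comult_unit A.mult_unit_right lin_rules)

sublocale H: unital_algebra H
  by (rule H_unital_algebra)

sublocale H: counital_coalgebra H
  by (rule H_counital_coalgebra)

text \<open>Right multiplication by \<open>unit B \<otimes> c\<close> touches only the \<A>-legs, so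
  \<open>x\<close> may be arbitrary here and no compatibility between action and coaction
  enters.\<close>

lemma H_comult_mult_right:
  "comult H (mult H (x \<otimes> (unit B \<otimes> c))) = H.mult2 (comult H x \<otimes> comult H (unit B \<otimes> c))"
proof -
  have 1: "comult H (mult H ((b \<otimes> a) \<otimes> (unit B \<otimes> c))) =
      H.mult2 (comult H (b \<otimes> a) \<otimes> comult H (unit B \<otimes> c))" for b a
    by (simp add: H_mult_right H_comult_A)
      (simp add: H_comult_pure A.sw_comult_mult A.mult_assoc_pure H.mult2_pure H_mult_right
        H.mult2_rules lin_rules sw_swap[of "comult A c"])
  show ?thesis
    by (rule clinear_tensor_eqI[where t = x]) (simp_all add: 1 H_rules H.mult2_rules lin_rules)
qed

text \<open>The braiding inside \<open>comult B\<close> contributes one coaction on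
  \<open>b2\<close> and the coproduct of \<open>H\<close> a second one. The comodule axiom merges
  them into a coproduct of \<open>p\<close>: one leg acts on \<open>d1\<close>, the other multiplies
  \<open>u\<close>, which is exactly the product of \<open>b1 \<otimes> p\<close> with
  \<open>d1 \<otimes> u\<close> in \<open>H\<close>.\<close>

lemma H_comult_mult_B:
  "comult H (mult H ((b \<otimes> unit A) \<otimes> (d \<otimes> unit A))) =
    H.mult2 (comult H (b \<otimes> unit A) \<otimes> comult H (d \<otimes> unit A))" (is "?l = ?r")
proof -
  have "?l = sw (comult B b) (\<lambda>b1 b2. sw (comult B d) (\<lambda>d1 d2. sw (coact V b2) (\<lambda>p q.
      sw (coact V q) (\<lambda>s t. sw (coact V d2) (\<lambda>u v. (b1 \<bullet> (p \<rhd> d1) \<otimes> s \<cdot> u) \<otimes> (t \<bullet> v \<otimes> unit A))))))"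
    by (simp add: H_mult_left H_comult_B sw_bcomult_bmult sw_coact_bmult lin_rules)
  also have "\<dots> = sw (comult B b) (\<lambda>b1 b2. sw (comult B d) (\<lambda>d1 d2. sw (coact V b2) (\<lambda>p q.
      sw (comult A p) (\<lambda>s t. sw (coact V d2) (\<lambda>u v. (b1 \<bullet> (s \<rhd> d1) \<otimes> t \<cdot> u) \<otimes> (q \<bullet> v \<otimes> unit A))))))"
    by (intro sw_cong sw_coact_comult[symmetric]) (simp_all add: trilin_def lin_rules)
  also have "\<dots> = sw (comult B b) (\<lambda>b1 b2. sw (comult B d) (\<lambda>d1 d2. sw (coact V b2) (\<lambda>p q.
      sw (coact V d2) (\<lambda>u v. sw (comult A p) (\<lambda>s t. (b1 \<bullet> (s \<rhd> d1) \<otimes> t \<cdot> u) \<otimes> (q \<bullet> v \<otimes> unit A))))))"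
    by (intro sw_cong sw_swap)
  also have "\<dots> = sw (comult B b) (\<lambda>b1 b2. sw (comult B d) (\<lambda>d1 d2. sw (coact V d2) (\<lambda>u v.
      sw (coact V b2) (\<lambda>p q. sw (comult A p) (\<lambda>s t. (b1 \<bullet> (s \<rhd> d1) \<otimes> t \<cdot> u) \<otimes> (q \<bullet> v \<otimes> unit A))))))"
    by (intro sw_cong sw_swap)
  also have "\<dots> = ?r"
    by (simp add: H_comult_B H.mult2_pure H_mult_pure A.sw_comult_unit act_unit A.mult_unit_left
        H.mult2_rules lin_rules sw_order sw_swap[of "comult B d" "comult B b"])
  finally show ?thesis .
qed

text \<open>With four legs of \<open>a\<close> in play, the outer two are the same on both sides.
  The inner two differ by the Yetter-Drinfeld condition, applied once they are exposed as the
  coproduct of one element.\<close>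

lemma H_comult_mult_mixed:
  "comult H (mult H ((unit B \<otimes> a) \<otimes> (d \<otimes> unit A))) =
    H.mult2 (comult H (unit B \<otimes> a) \<otimes> comult H (d \<otimes> unit A))" (is "?l = ?r")
proof -
  let ?C = "comult A" and ?G = "coact V"
  have "?l = sw (comult B d) (\<lambda>d1 d2. sw (?C a) (\<lambda>x y. sw (?C x) (\<lambda>x1 x2. sw (?C y) (\<lambda>y1 y2.
      sw (?G (x2 \<rhd> d2)) (\<lambda>p q. (x1 \<rhd> d1 \<otimes> p \<cdot> y1) \<otimes> (q \<otimes> y2))))))"
    by (simp add: H_mult_mixed H_comult_pure H_rules sw_bcomult_act lin_rules
        sw_swap[of "comult A x" "comult B y" for x y] sw_swap[of "coact V x" "comult A y" for x y])
  also have "\<dots> = sw (comult B d) (\<lambda>d1 d2. sw (?C a) (\<lambda>x1 z. sw (?C z) (\<lambda>w y2. sw (?C w) (\<lambda>x2 y1.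
      sw (?G (x2 \<rhd> d2)) (\<lambda>p q. (x1 \<rhd> d1 \<otimes> p \<cdot> y1) \<otimes> (q \<otimes> y2))))))"
    by (intro sw_cong A.sw_coassoc_middle) (simp_all add: lin_rules)
  also have "\<dots> = sw (comult B d) (\<lambda>d1 d2. sw (?C a) (\<lambda>x1 z. sw (?C z) (\<lambda>w y2. sw (?C w) (\<lambda>x2 y1.
      sw (?G d2) (\<lambda>p q. (x1 \<rhd> d1 \<otimes> x2 \<cdot> p) \<otimes> (y1 \<rhd> q \<otimes> y2))))))"
    by (intro sw_cong sw_yetter_drinfeld) (simp add: lin_rules)
  also have "\<dots> = sw (comult B d) (\<lambda>d1 d2. sw (?C a) (\<lambda>x y. sw (?C x) (\<lambda>x1 x2. sw (?C y) (\<lambda>y1 y2.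
      sw (?G d2) (\<lambda>p q. (x1 \<rhd> d1 \<otimes> x2 \<cdot> p) \<otimes> (y1 \<rhd> q \<otimes> y2))))))"
    by (intro sw_cong A.sw_coassoc_middle[symmetric]) (simp_all add: lin_rules)
  also have "\<dots> = sw (comult B d) (\<lambda>d1 d2. sw (?C a) (\<lambda>x y. sw (?C y) (\<lambda>y1 y2. sw (?C x) (\<lambda>x1 x2.
      sw (?G d2) (\<lambda>p q. (x1 \<rhd> d1 \<otimes> x2 \<cdot> p) \<otimes> (y1 \<rhd> q \<otimes> y2))))))"
    by (intro sw_cong sw_swap)
  also have "\<dots> = ?r"
    by (simp add: H_comult_A H_comult_B H.mult2_pure H_mult_pure B.mult_unit_left A.mult_unit_right
        H.mult2_rules lin_rules
        sw_swap[of "comult A x" "comult B y" for x y] sw_swap[of "coact V x" "comult A y" for x y])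
  finally show ?thesis .
qed

lemma H_split: "b \<otimes> a = mult H ((b \<otimes> unit A) \<otimes> (unit B \<otimes> a))"
  by (simp add: H_mult_left B.mult_unit_right)

lemma H_comult_mult:
  "comult H (mult H (x \<otimes> y)) = H.mult2 (comult H x \<otimes> comult H y)"
proof -
  let ?D = "comult H"
  \<comment> \<open>The factor \<open>unit B \<otimes> c\<close> of a general right argument peels
    off by \<open>H_comult_mult_right\<close>. Hence, for fixed \<open>x\<close>, only right
    arguments from \<B> matter; this is used for \<open>x\<close> equal to either kind of
    generator.\<close>
  have step: "?D (mult H (x \<otimes> y)) = H.mult2 (?D x \<otimes> ?D y)"
    if "\<And>d. ?D (mult H (x \<otimes> (d \<otimes> unit A))) = H.mult2 (?D x \<otimes> ?D (d \<otimes> unit A))" for x y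
  proof -
    have 1: "?D (mult H (x \<otimes> (d \<otimes> c))) = H.mult2 (?D x \<otimes> ?D (d \<otimes> c))" for d c
    proof -
      have "?D (mult H (x \<otimes> (d \<otimes> c))) = ?D (mult H (mult H (x \<otimes> (d \<otimes> unit A)) \<otimes> (unit B \<otimes> c)))"
        by (simp add: H_mult_assoc flip: H_split)
      also have "\<dots> = H.mult2 (?D x \<otimes> H.mult2 (?D (d \<otimes> unit A) \<otimes> ?D (unit B \<otimes> c)))"
        by (simp only: H_comult_mult_right that H.mult2_assoc)
      also have "\<dots> = H.mult2 (?D x \<otimes> ?D (d \<otimes> c))"
        by (simp only: H_comult_mult_right[symmetric] H_split[symmetric])
      finally show ?thesis .
    qed
    show ?thesis
      by (rule clinear_tensor_eqI[where t = y])
        (simp_all add: 1 H_rules H.mult2_rules clinear_rules)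
  qed
  have 1: "?D (mult H ((b \<otimes> a) \<otimes> y)) = H.mult2 (?D (b \<otimes> a) \<otimes> ?D y)" for b a
  proof -
    have "?D (mult H ((b \<otimes> a) \<otimes> y)) = ?D (mult H ((b \<otimes> unit A) \<otimes> mult H ((unit B \<otimes> a) \<otimes> y)))"
      by (simp flip: H_mult_assoc H_split)
    also have "\<dots> = H.mult2 (H.mult2 (?D (b \<otimes> unit A) \<otimes> ?D (unit B \<otimes> a)) \<otimes> ?D y)"
      by (simp only: step[OF H_comult_mult_B] step[OF H_comult_mult_mixed] H.mult2_assoc)
    also have "\<dots> = H.mult2 (?D (b \<otimes> a) \<otimes> ?D y)"
      by (simp only: step[OF H_comult_mult_B, symmetric] H_split[symmetric])
    finally show ?thesis .
  qed
  show ?thesis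
    by (rule clinear_tensor_eqI[where t = x])
      (simp_all add: 1 H_rules H.mult2_rules clinear_rules)
qed

lemma H_counit_mult: "counit H (mult H (x \<otimes> y)) = counit H x * counit H y"
proof -
  have 1: "counit H (mult H ((b \<otimes> a) \<otimes> (d \<otimes> c))) = counit H (b \<otimes> a) * counit H (d \<otimes> c)" for b a d c
  proof -
    have "counit H (mult H ((b \<otimes> a) \<otimes> (d \<otimes> c))) =
      sw (comult A a) (\<lambda>x y. counit A x *\<^sub>C (counit B b * counit B d * counit A y * counit A c))"
      by (simp add: H_mult_pure H_rules H_counit_pure bcounit_bmult bcounit_act A.counit_mult mult_ac)
    also have "\<dots> = counit H (b \<otimes> a) * counit H (d \<otimes> c)"
      by (subst A.sw_counit_left) (simp_all add: lin_rules H_counit_pure)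
    finally show ?thesis .
  qed
  have 2: "counit H (mult H ((b \<otimes> a) \<otimes> y)) = counit H (b \<otimes> a) * counit H y" for b a
    by (rule clinear_tensor_eqI[where t = y]) (simp_all add: 1 H_rules clinear_rules)
  show ?thesis
    by (rule clinear_tensor_eqI[where t = x]) (simp_all add: 2 H_rules clinear_rules)
qed

lemma H_bialgebra: "bialgebra H"
proof (intro bialgebra.intro H_unital_algebra H_counital_coalgebra bialgebra_axioms.intro)
  show "algebra_hom (mult H) (unit H) (tensor_mult flip (mult H) (mult H)) (unit H \<otimes> unit H) (comult H)"
    unfolding algebra_hom_def H.mult2_def[symmetric]
  proof (intro conjI additive_eq_on_tensors)
    show "comult H (unit H) = unit H \<otimes> unit H"
      by (simp add: H_unit H_comult_A A.sw_comult_unit lin_rules)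
  qed (simp_all add: H_comult_mult tensor_map_clinear(2) clinear_additive H_rules H.mult2_rules
      clinear_rules)
  show "algebra_hom (mult H) (unit H) lunit 1 (counit H)"
    unfolding algebra_hom_def
    by (intro conjI additive_eq_on_tensors)
      (simp_all add: H_counit_mult tensor_map_clinear(2) clinear_additive H_rules clinear_rules
        lunit_pure H_unit H_counit_pure A.counit_unit bcounit_bunit)
qed

section \<open>The involution of \<open>H\<close>\<close>

text \<open>This explains the formula for \<open>star H\<close>: it is what antimultiplicativity
  forces on \<open>H_split\<close> once the involutions of \<A> and \<B> are prescribed on the
  generators.\<close>

lemma H_star_split: "star H (b \<otimes> a) = mult H ((unit B \<otimes> star A a) \<otimes> (invol V b \<otimes> unit A))"
  by (simp add: H_star_pure H_mult_mixed)

lemma H_star_A: "star H (unit B \<otimes> a) = unit B \<otimes> star A a"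
  by (simp add: H_star_split binvol_bunit H_mult_right A.mult_unit_right)

lemma H_star_B: "star H (b \<otimes> unit A) = invol V b \<otimes> unit A"
  by (simp add: H_star_split A.star_unit H_mult_left B.mult_unit_left)

text \<open>The mixed relation is where antimultiplicativity could fail. Applying
  \<open>star H\<close> to \<open>(x \<rhd> d) \<otimes> y\<close> lets a leg of \<open>y\<close>
  act on the conjugate of \<open>x \<rhd> d\<close>, and \<open>act_invol_cancel\<close> removes
  both actions.\<close>

lemma H_star_mixed: "star H (mult H ((unit B \<otimes> a) \<otimes> (d \<otimes> unit A))) = invol V d \<otimes> star A a"
proof -
  let ?C = "comult A" and ?i = "invol V"
  \<comment> \<open>In terms of \<open>e\<close> the summands below are linear rather than antilinear, as coassociativity requires.\<close>
  define e where "e = star A a"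
  then have a: "a = star A e"
    by (simp add: A.star_star)
  have "antilinear (\<lambda>x. star A x \<rhd> d)"
    using antilinear_comp[OF _ A.star_antilinear, of "\<lambda>x. x \<rhd> d"] by (simp add: comp_def lin_rules)
  then have lin: "clinear (\<lambda>x. ?i (star A x \<rhd> d))"
    by (rule clinear_compose_antilinear[OF invol_antilinear])
  have "star H (mult H ((unit B \<otimes> a) \<otimes> (d \<otimes> unit A))) =
      sw (?C e) (\<lambda>x y. sw (?C y) (\<lambda>u v. (u \<rhd> ?i (star A x \<rhd> d)) \<otimes> v))"
    by (simp add: a H_mult_mixed A.sw_comult_star antilinear_sw[OF H_star_antilinear] H_star_pure
        A.star_star lin_rules)
  also have "\<dots> = sw (?C e) (\<lambda>x y. sw (?C x) (\<lambda>u v. (v \<rhd> ?i (star A u \<rhd> d)) \<otimes> y))"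
    by (rule A.sw_coassoc[symmetric]) (simp add: trilin_def lin_rules lin)
  also have "\<dots> = sw (?C e) (\<lambda>x y. counit A x *\<^sub>C (?i d \<otimes> y))"
    by (simp add: tensor_sw_left[symmetric] act_invol_cancel tensor_scaleC_left)
  also have "\<dots> = ?i d \<otimes> e"
    by (rule A.sw_counit_left) (simp add: lin_rules)
  finally show ?thesis
    by (simp add: e_def)
qed

text \<open>In generators, the part from \<open>c\<close> comes off on the left and the part from
  \<open>b\<close> on the right. What is left between them is the star of a mixed product, which
  \<open>H_star_mixed\<close> reverses.\<close>

lemma H_star_mult: "star H (mult H (x \<otimes> y)) = mult H (star H y \<otimes> star H x)"
proof -
  let ?i = "invol V" and ?m = "\<lambda>x y. mult H (x \<otimes> y)"
  have 1: "star H (?m (b \<otimes> a) (d \<otimes> c)) = ?m (star H (d \<otimes> c)) (star H (b \<otimes> a))" for b a d c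
  proof -
    have A: "unit B \<otimes> x \<cdot> y = ?m (unit B \<otimes> x) (unit B \<otimes> y)" for x y
      by (simp add: H_mult_right)
    have B: "x \<bullet> y \<otimes> unit A = ?m (x \<otimes> unit A) (y \<otimes> unit A)" for x y
      by (simp add: H_mult_left)
    have "star H (?m (b \<otimes> a) (d \<otimes> c)) =
        sw (comult A a) (\<lambda>x y. star H (b \<bullet> (x \<rhd> d) \<otimes> y \<cdot> c))"
      by (simp add: H_mult_pure antilinear_sw[OF H_star_antilinear])
    also have "\<dots> = sw (comult A a) (\<lambda>x y.
        ?m (unit B \<otimes> star A c) (?m (star H (x \<rhd> d \<otimes> y)) (?i b \<otimes> unit A)))"
      by (simp only: H_star_split A.star_mult_pure binvol_bmult A B H_mult_assoc)
    also have "\<dots> = ?m (unit B \<otimes> star A c)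
        (?m (star H (?m (unit B \<otimes> a) (d \<otimes> unit A))) (?i b \<otimes> unit A))"
      by (simp add: H_mult_mixed antilinear_sw[OF H_star_antilinear] H_rules tensor_sw_left
          tensor_sw_right)
    also have "\<dots> = ?m (unit B \<otimes> star A c)
        (?m (?m (?i d \<otimes> unit A) (unit B \<otimes> star A a)) (?i b \<otimes> unit A))"
      by (simp only: H_star_mixed H_split[symmetric])
    also have "\<dots> = ?m (star H (d \<otimes> c)) (star H (b \<otimes> a))"
      by (simp only: H_star_split H_mult_assoc)
    finally show ?thesis .
  qed
  note add = additive_antilinear_clinear[OF H_star_antilinear]
    additive_clinear_antilinear[OF _ H_star_antilinear, where g = "\<lambda>z. mult H (z \<otimes> w)" for w]
    additive_clinear_antilinear[OF _ H_star_antilinear, where g = "\<lambda>z. mult H (w \<otimes> z)" for w]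
  have 2: "star H (?m (b \<otimes> a) y) = ?m (star H y) (star H (b \<otimes> a))" for b a
    by (rule additive_tensor_eqI[where t = y]) (simp_all add: 1 add H_rules clinear_rules)
  show ?thesis
    by (rule additive_tensor_eqI[where t = x]) (simp_all add: 2 add H_rules clinear_rules)
qed

lemma H_star_star: "star H (star H x) = x"
proof (rule additive_tensor_eqI[where t = x])
  show "star H (star H (b \<otimes> a)) = b \<otimes> a" for b a
    by (simp add: H_star_split[of b a] H_star_mult H_star_A H_star_B A.star_star binvol_star
        flip: H_split)
qed (simp_all add: clinear_additive clinear_compose_antilinear H_star_antilinear clinear_ident)

lemma H_star_algebra: "star_algebra H"
proof (intro star_algebra.intro H_unital_algebra star_algebra_axioms.intro)
  show "involution (star H)"
    by (simp add: involution_def H_star_antilinear fun_eq_iff H_star_star)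
  show "star H \<circ> mult H = mult H \<circ> (star H \<otimes>\<^sub>m star H) \<circ> flip"
  proof (rule additive_eq_on_tensors)
    show "additive (star H \<circ> mult H)" "additive (mult H \<circ> (star H \<otimes>\<^sub>m star H) \<circ> flip)"
      by (simp_all add: comp_def additive_antilinear_clinear H_star_antilinear H_clinear
          additive_compose[OF clinear_additive[OF H_clinear(1)]
            additive_antilinear_clinear[OF tensor_map_antilinear(1) flip_clinear]])
  qed (simp add: H_star_mult flip_pure tensor_map_antilinear H_star_antilinear)
qed

sublocale H: star_algebra H
  by (rule H_star_algebra)

text \<open>Both sides reverse or preserve products in the same way, so generators suffice. On \<B>,
  the action occurring in the braided involution of \<open>B \<otimes> B\<close> turns, by the
  comodule axiom, into the action built into \<open>star H\<close> on the first tensor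
  factor.\<close>

lemma H_comult_star: "comult H (star H x) = (star H \<otimes>\<^sub>m star H) (comult H x)"
proof (rule additive_tensor_eqI[where t = x])
  let ?s = "star H \<otimes>\<^sub>m star H" and ?i = "invol V"
  have s: "additive ?s" "?s (x \<otimes> y) = star H x \<otimes> star H y" for x y
    by (simp_all add: tensor_map_antilinear H_star_antilinear antilinear_additive)
  have A: "comult H (star H (unit B \<otimes> a)) = ?s (comult H (unit B \<otimes> a))" for a
    by (simp add: H_star_A H_comult_A A.sw_comult_star additive_sw[OF s(1)] s(2) lin_rules)
  have B: "comult H (star H (b \<otimes> unit A)) = ?s (comult H (b \<otimes> unit A))" for b
  proof -
    have "comult H (star H (b \<otimes> unit A)) = sw (comult B b) (\<lambda>b1 b2. sw (coact V (?i b2)) (\<lambda>p q.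
        sw (coact V q) (\<lambda>s t. ((p \<rhd> ?i b1) \<otimes> s) \<otimes> (t \<otimes> unit A))))"
      by (simp add: H_star_B H_comult_B sw_bcomult_star sw_coact_star lin_rules)
    also have "\<dots> = sw (comult B b) (\<lambda>b1 b2. sw (coact V (?i b2)) (\<lambda>p q.
        sw (comult A p) (\<lambda>s t. ((s \<rhd> ?i b1) \<otimes> t) \<otimes> (q \<otimes> unit A))))"
      by (intro sw_cong sw_coact_comult[symmetric]) (simp_all add: trilin_def lin_rules)
    also have "\<dots> = ?s (comult H (b \<otimes> unit A))"
      by (simp add: H_comult_B additive_sw[OF s(1)] s(2) A.star_unit A.sw_comult_unit act_unit
          H_star_pure sw_coact_star lin_rules)
    finally show ?thesis .
  qed
  show "comult H (star H (b \<otimes> a)) = ?s (comult H (b \<otimes> a))" for b a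
    by (subst (1 2) H_split)
      (simp add: H_star_mult H_comult_mult A B H.star_mult2)
  show "additive (\<lambda>x. comult H (star H x))" "additive (\<lambda>x. ?s (comult H x))"
    by (simp_all add: additive_clinear_antilinear additive_antilinear_clinear H_clinear
        H_star_antilinear tensor_map_antilinear)
qed

lemma H_star_bialgebra: "star_bialgebra H"
  by (intro star_bialgebra.intro H_bialgebra H_star_algebra star_bialgebra_axioms.intro ext)
    (simp add: H_comult_star)

section \<open>The embedding of \<open>B\<close> and the projection onto it\<close>

lemma H_embedding: "star_algebra_iso_onto B H (\<lambda>b. b \<otimes> unit A) {b \<otimes> unit A | b. True}"
  unfolding star_algebra_iso_onto_def
proof (intro conjI)
  let ?\<iota> = "\<lambda>b. b \<otimes> unit A"
  have lin: "clinear ?\<iota>"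
    by (simp add: clinear_rules)
  show "star_subalgebra H {b \<otimes> unit A | b. True}"
    unfolding star_subalgebra_def complex_vector.subspace_def
    by (auto simp: H_unit H_mult_left H_star_B)
      (metis tensor_scaleC_left complex_vector.scale_zero_left, metis tensor_add_left,
        metis tensor_scaleC_left)
  \<comment> \<open>Applying the counit of \<A> gives a left inverse of the embedding, hence
    injectivity.\<close>
  have "runit ((id \<otimes>\<^sub>m counit A) (?\<iota> b)) = b" for b
    by (simp add: tensor_map_clinear clinear_id A.counit_clinear runit_pure A.counit_unit scaleC_one)
  then show "bij_betw ?\<iota> UNIV {b \<otimes> unit A | b. True}"
    by (auto simp: bij_betw_def intro!: inj_on_inverseI[where g = "\<lambda>x. runit ((id \<otimes>\<^sub>m counit A) x)"])
  show "algebra_hom (mult B) (unit B) (mult H) (unit H) ?\<iota>"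
    unfolding algebra_hom_def
    by (intro conjI additive_eq_on_tensors lin)
      (simp_all add: H_mult_left H_unit tensor_map_clinear(2) lin clinear_additive clinear_comp
        clinear_compose[OF lin] B.mult_rules H_rules clinear_rules)
  show "?\<iota> \<circ> star B = star H \<circ> ?\<iota>"
    by (simp add: fun_eq_iff H_star_B B.star_eq)
qed

lemma H_comult_embedding:
  "comult H \<circ> (\<lambda>b. b \<otimes> unit A) = (id \<otimes>\<^sub>m (\<lambda>b. b \<otimes> unit A)) \<circ> assoc' \<circ> (id \<otimes>\<^sub>m coact V) \<circ> comult B"
  by (simp add: fun_eq_iff H_comult_B lin_rules)

text \<open>The counit is multiplicative on the leg \<open>p \<cdot> a1\<close>; its value at
  \<open>p\<close> undoes the coaction, and its values at \<open>a1\<close> and \<open>a2\<close>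
  collapse the coproduct of \<open>a\<close>.\<close>

lemma H_comult_projection:
  assumes \<pi>: "\<pi> = runit \<circ> (id \<otimes>\<^sub>m counit A)"
  shows "(\<pi> \<otimes>\<^sub>m \<pi>) \<circ> comult H = comult B \<circ> \<pi>"
proof (rule additive_eq_on_tensors)
  have lin: "clinear \<pi>"
    unfolding \<pi> by (simp add: lin_rules)
  have pure: "\<pi> (b \<otimes> a) = counit A a *\<^sub>C b" for b a
    by (simp add: \<pi> lin_rules)
  show "((\<pi> \<otimes>\<^sub>m \<pi>) \<circ> comult H) (b \<otimes> a) = (comult B \<circ> \<pi>) (b \<otimes> a)" for b a
  proof -
    have "((\<pi> \<otimes>\<^sub>m \<pi>) \<circ> comult H) (b \<otimes> a) = sw (comult B b) (\<lambda>b1 b2. sw (coact V b2) (\<lambda>p q.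
        counit A p *\<^sub>C sw (comult A a) (\<lambda>a1 a2. counit A a1 *\<^sub>C (counit A a2 *\<^sub>C (b1 \<otimes> q)))))"
      by (simp add: H_comult_pure clinear_sw[OF tensor_map_clinear(1)[OF lin lin]]
          tensor_map_clinear(2)[OF lin lin] pure A.counit_mult tensor_scaleC_left tensor_scaleC_right
          scaleC_scaleC mult_ac scaleC_sw)
    also have "\<dots> = counit A a *\<^sub>C sw (comult B b) (\<lambda>b1 b2. b1 \<otimes> b2)"
      by (simp add: A.sw_counit_left sw_coact_counit lin_rules del: scaleC_sw scaleC_scaleC
          complex_vector.scale_scale)
        (simp add: scaleC_sw)
    finally show ?thesis
      by (simp add: pure sw_tensor lin_rules(1) clinear_scale[OF B.comult_clinear])
  qed
qed (simp_all add: \<pi> clinear_additive H_rules B.comult_rules A.comult_rules clinear_rules)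

end


section \<open>The two categories\<close>

lemma bosonization_data_hopf:
  assumes "hopf_star_algebra A S" "hopf_object A S V" "braided_star_bialgebra A V B"
  shows "bosonization_data A V B"
proof -
  interpret A: hopf_star_algebra A S by fact
  interpret V: hopf_object A S V by fact
  note rules = sw_rules A.mult_rules A.comult_rules V.act_rules V.coact_rules A.antipode_clinear
    clinear_compose[OF A.antipode_clinear] clinear_sw[OF A.antipode_clinear]
  show ?thesis
  proof (intro bosonization_data.intro bosonization_data_axioms.intro assms A.star_bialgebra_axioms
      V.left_module_axioms V.star_comodule_axioms)
    fix a v
    show "sw (comult A a) (\<lambda>x y. sw (coact V v) (\<lambda>p q. mult A (x \<otimes> p) \<otimes> act V (y \<otimes> q))) =
      sw (comult A a) (\<lambda>x y. sw (coact V (act V (x \<otimes> v))) (\<lambda>p q. mult A (p \<otimes> y) \<otimes> q))"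
      using fun_cong[OF V.yetter_drinfeld, of "a \<otimes> v"]
      by (simp add: mid_flip_sw flip23_sw rules)
    let ?t = "\<lambda>x. star A (S x)"
    have t: "clinear (\<lambda>x. ?t (star A x))"
      by (intro clinear_compose_antilinear[of "star A" "\<lambda>x. S (star A x)"] A.star_antilinear)
        (use antilinear_comp[OF A.antipode_clinear A.star_antilinear] in \<open>simp add: comp_def\<close>)
    \<comment> \<open>The antipode axiom is taken at \<open>star A a\<close> and then starred. This
      reverses the factors and puts the second leg of \<open>a\<close> in front, as the cancellation
      identity requires.\<close>
    have "star A (sw (comult A a) (\<lambda>x y. mult A (S (star A x) \<otimes> star A y))) =
        star A (sw (comult A (star A a)) (\<lambda>x y. mult A (S x \<otimes> y)))"
      by (simp add: A.sw_comult_star rules)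
    also have "sw (comult A (star A a)) (\<lambda>x y. mult A (S x \<otimes> y)) = counit A (star A a) *\<^sub>C unit A"
      using fun_cong[OF A.antipode_left, of "star A a"] by (simp add: rules)
    finally have "sw (comult A a) (\<lambda>x y. mult A (y \<otimes> ?t (star A x))) = counit A a *\<^sub>C unit A"
      by (simp add: A.star_rules A.star_mult_pure A.star_star A.counit_star A.star_unit)
    from arg_cong[OF this, of "\<lambda>x. act V (x \<otimes> invol V v)"]
    show "sw (comult A a) (\<lambda>x y. act V (y \<otimes> invol V (act V (star A x \<otimes> v)))) =
        counit A a *\<^sub>C invol V v"
      by (simp add: V.invol_act rules V.act_mult_pure[OF A.mult_clinear, symmetric]
          V.act_unit tensor_scaleC_left)
  qed
qed

section \<open>Identities of the universal R-form\<close>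

context coquasitriangular_star_bialgebra
begin

lemmas r_rules = r_clinear clinear_compose[OF r_clinear] clinear_sw[OF r_clinear]
  r'_clinear clinear_compose[OF r'_clinear] clinear_sw[OF r'_clinear]

lemmas conv_rules = mid_clinear flip23_clinear sw_rules mult_rules comult_rules r_rules

lemma r_r'_inverse:
  "sw (comult A a) (\<lambda>a1 a2. sw (comult A b) (\<lambda>b1 b2. r (a1 \<otimes> b1) * r' (a2 \<otimes> b2))) =
    counit A a * counit A b"
  using fun_cong[OF r_inverse_right, of "a \<otimes> b"]
  by (simp add: convolution_def tensor_comult_def mid_flip_sw conv_rules)

lemma r'_r_inverse:
  "sw (comult A a) (\<lambda>a1 a2. sw (comult A b) (\<lambda>b1 b2. r' (a1 \<otimes> b1) * r (a2 \<otimes> b2))) =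
    counit A a * counit A b"
  using fun_cong[OF r_inverse_left, of "a \<otimes> b"]
  by (simp add: convolution_def tensor_comult_def mid_flip_sw conv_rules)

lemma r_mult_left_pure:
  "r (mult A (a \<otimes> b) \<otimes> c) = sw (comult A c) (\<lambda>c1 c2. r (a \<otimes> c1) * r (b \<otimes> c2))"
proof -
  have "r (mult A (a \<otimes> b) \<otimes> c) = sw (comult A c) (\<lambda>c1 c2.
      sw (comult A a) (\<lambda>a1 a2. counit A a2 *\<^sub>C r (a1 \<otimes> c1)) *
      sw (comult A b) (\<lambda>b1 b2. counit A b1 *\<^sub>C r (b2 \<otimes> c2)))"
    using fun_cong[OF r_mult_left, of "(a \<otimes> b) \<otimes> c"]
    by (simp add: convolution_def tensor_comult_def mid_flip_sw leg13_def leg23_def flip23_sw conv_rules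
        sw_swap[of "comult A c"] sw_swap[of "comult A b" "comult A a"] mult_ac)
  also have "\<dots> = sw (comult A c) (\<lambda>c1 c2. r (a \<otimes> c1) * r (b \<otimes> c2))"
    by (subst sw_counit_right sw_counit_left, simp add: conv_rules)+ (rule refl)
  finally show ?thesis .
qed

lemma mult_op_pure:
  "mult A (b \<otimes> a) = sw (comult A a) (\<lambda>a1 a2. sw (comult A b) (\<lambda>b1 b2. r' (a2 \<otimes> b2) *\<^sub>C
    sw (comult A a1) (\<lambda>x y. sw (comult A b1) (\<lambda>z w. r (x \<otimes> z) *\<^sub>C mult A (y \<otimes> w)))))"
  using fun_cong[OF mult_op, of "a \<otimes> b"]
  by (simp add: convolution_def tensor_comult_def mid_flip_sw conv_rules mult_unit_left mult_unit_right
      tensor_scaleC_left tensor_scaleC_right)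

text \<open>Convolving the opposite product, given by \<open>mult_op\<close>, with \<open>r'\<close>
  on the left cancels \<open>r\<close>; what remains is the product convolved with \<open>r'\<close>
  on the right.\<close>

lemma r'_mult_commute:
  "sw (comult A a) (\<lambda>a1 a2. sw (comult A b) (\<lambda>b1 b2. r' (a1 \<otimes> b1) *\<^sub>C mult A (b2 \<otimes> a2))) =
    sw (comult A a) (\<lambda>a1 a2. sw (comult A b) (\<lambda>b1 b2. r' (a2 \<otimes> b2) *\<^sub>C mult A (a1 \<otimes> b1)))"
  (is "?l = ?r")
proof -
  let ?C = "comult A"
  have 1: "sw (?C a) (\<lambda>u v. sw (?C b) (\<lambda>w z. r' (u \<otimes> w) *\<^sub>C
      sw (?C v) (\<lambda>p q. sw (?C z) (\<lambda>s t. r (p \<otimes> s) *\<^sub>C mult A (q \<otimes> t))))) = mult A (a \<otimes> b)" for a b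
  proof -
    have "sw (?C a) (\<lambda>u v. sw (?C b) (\<lambda>w z. r' (u \<otimes> w) *\<^sub>C
        sw (?C v) (\<lambda>p q. sw (?C z) (\<lambda>s t. r (p \<otimes> s) *\<^sub>C mult A (q \<otimes> t))))) =
      sw (?C a) (\<lambda>u v. sw (?C b) (\<lambda>w z. sw (?C v) (\<lambda>p q. sw (?C z) (\<lambda>s t.
        (r' (u \<otimes> w) * r (p \<otimes> s)) *\<^sub>C mult A (q \<otimes> t)))))"
      by (simp add: scaleC_sw scaleC_scaleC)
    also have "\<dots> = sw (?C a) (\<lambda>x q. sw (?C b) (\<lambda>y t. sw (?C x) (\<lambda>u p. sw (?C y) (\<lambda>w s.
        (r' (u \<otimes> w) * r (p \<otimes> s)) *\<^sub>C mult A (q \<otimes> t)))))"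
      by (rule sw_coassoc2[symmetric]) (simp_all add: conv_rules)
    also have "\<dots> = sw (?C a) (\<lambda>x q. counit A x *\<^sub>C sw (?C b) (\<lambda>y t. counit A y *\<^sub>C mult A (q \<otimes> t)))"
      by (simp add: scaleC_sw_left[symmetric] r'_r_inverse scaleC_sw scaleC_scaleC)
    also have "\<dots> = mult A (a \<otimes> b)"
      by (subst sw_counit_left, simp add: conv_rules)+ (rule refl)
    finally show ?thesis .
  qed
  have "?l = sw (?C a) (\<lambda>a1 u. sw (?C b) (\<lambda>b1 w. sw (?C u) (\<lambda>v a4. sw (?C w) (\<lambda>z b4.
      r' (a4 \<otimes> b4) *\<^sub>C r' (a1 \<otimes> b1) *\<^sub>C
        sw (?C v) (\<lambda>p q. sw (?C z) (\<lambda>s t. r (p \<otimes> s) *\<^sub>C mult A (q \<otimes> t)))))))"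
    by (subst mult_op_pure) (simp add: scaleC_sw scaleC_scaleC mult_ac)
  also have "\<dots> = sw (?C a) (\<lambda>u a4. sw (?C b) (\<lambda>w b4. sw (?C u) (\<lambda>a1 v. sw (?C w) (\<lambda>b1 z.
      r' (a4 \<otimes> b4) *\<^sub>C r' (a1 \<otimes> b1) *\<^sub>C
        sw (?C v) (\<lambda>p q. sw (?C z) (\<lambda>s t. r (p \<otimes> s) *\<^sub>C mult A (q \<otimes> t)))))))"
    by (rule sw_coassoc2[symmetric]) (simp_all add: conv_rules)
  also have "\<dots> = ?r"
    by (simp only: scaleC_sw[symmetric] 1)
  finally show ?thesis .
qed

end

section \<open>The action induced by \<open>r'\<close> and its convolution inverse\<close>

locale coquasitriangular_action = coquasitriangular_star_bialgebra A r r' +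
  coquasitriangular_object A r' V
  for A :: "'a::complex_vector bialg" and r r' :: "'a \<otimes> 'a \<Rightarrow> complex"
    and V :: "('a, 'v::complex_vector) object"
begin

text \<open>It stands in for the action of an inverse antipode. The axioms describe
  \<open>r\<close>, not \<open>r'\<close>, on products, so the module law for \<open>act V\<close>
  is obtained through this map.\<close>

definition inv_act where "inv_act a v = sw (coact V v) (\<lambda>p q. r (a \<otimes> p) *\<^sub>C q)"

lemma act_sw: "act V (a \<otimes> v) = sw (coact V v) (\<lambda>p q. r' (a \<otimes> p) *\<^sub>C q)"
  by (simp add: act_eq conv_rules coact_rules)

lemma act_lin: "clinear (act V)"
  unfolding act_eq by (simp add: conv_rules coact_rules)

lemmas act_lin_rules = act_lin clinear_compose[OF act_lin] clinear_sw[OF act_lin]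
  clinear_scale[OF act_lin]

lemma inv_act_lin: "clinear (inv_act a)" "clinear (\<lambda>a. inv_act a v)"
  by (simp_all add: inv_act_def[abs_def] conv_rules coact_rules)

lemmas inv_act_rules = inv_act_lin clinear_compose[OF inv_act_lin(1)]
  clinear_compose[OF inv_act_lin(2)] clinear_sw[OF inv_act_lin(1)] clinear_scale[OF inv_act_lin(1)]
  clinear_scale[OF inv_act_lin(2)]

lemma inv_act_inv_act: "inv_act a (inv_act b v) = inv_act (mult A (b \<otimes> a)) v"
proof -
  have "inv_act a (inv_act b v) = sw (coact V v) (\<lambda>p q. sw (coact V q) (\<lambda>s t.
      (r (b \<otimes> p) * r (a \<otimes> s)) *\<^sub>C t))"
    by (simp add: inv_act_def conv_rules coact_rules)
  also have "\<dots> = sw (coact V v) (\<lambda>p q. sw (comult A p) (\<lambda>s t. (r (b \<otimes> s) * r (a \<otimes> t)) *\<^sub>C q))"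
    by (rule sw_coact_comult[symmetric]) (simp_all add: trilin_def conv_rules)
  also have "\<dots> = inv_act (mult A (b \<otimes> a)) v"
    by (simp add: inv_act_def r_mult_left_pure scaleC_sw_left)
  finally show ?thesis .
qed

text \<open>The two successive coactions on \<open>v\<close> merge into a coproduct of its \<A>-leg,
  against which \<open>r\<close> and \<open>r'\<close> are convolution inverse.\<close>

lemma act_inv_act: "sw (comult A a) (\<lambda>x y. act V (y \<otimes> inv_act x v)) = counit A a *\<^sub>C v"
proof -
  have "sw (comult A a) (\<lambda>x y. act V (y \<otimes> inv_act x v)) =
      sw (coact V v) (\<lambda>p q. sw (coact V q) (\<lambda>s t. sw (comult A a) (\<lambda>x y.
        (r (x \<otimes> p) * r' (y \<otimes> s)) *\<^sub>C t)))"
    by (simp add: inv_act_def act_sw conv_rules coact_rules act_lin_rules tensor_scaleC_right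
        sw_swap[of "comult A a"])
  also have "\<dots> = sw (coact V v) (\<lambda>p q. sw (comult A p) (\<lambda>s t. sw (comult A a) (\<lambda>x y.
        (r (x \<otimes> s) * r' (y \<otimes> t)) *\<^sub>C q)))"
    by (rule sw_coact_comult[symmetric]) (simp_all add: trilin_def conv_rules)
  also have "\<dots> = sw (coact V v) (\<lambda>p q. counit A p *\<^sub>C (counit A a *\<^sub>C q))"
    by (simp add: sw_swap[of "comult A p" "comult A a" for p] scaleC_sw_left[symmetric] r_r'_inverse)
      (simp add: scaleC_scaleC mult.commute)
  also have "\<dots> = counit A a *\<^sub>C v"
    by (rule sw_coact_counit) (simp_all add: conv_rules)
  finally show ?thesis .
qed

lemma inv_act_act: "sw (comult A a) (\<lambda>x y. inv_act y (act V (x \<otimes> v))) = counit A a *\<^sub>C v"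
proof -
  have "sw (comult A a) (\<lambda>x y. inv_act y (act V (x \<otimes> v))) =
      sw (coact V v) (\<lambda>p q. sw (coact V q) (\<lambda>s t. sw (comult A a) (\<lambda>x y.
        (r' (x \<otimes> p) * r (y \<otimes> s)) *\<^sub>C t)))"
    by (simp add: inv_act_def act_sw conv_rules coact_rules act_lin_rules tensor_scaleC_right
        sw_swap[of "comult A a"])
  also have "\<dots> = sw (coact V v) (\<lambda>p q. sw (comult A p) (\<lambda>s t. sw (comult A a) (\<lambda>x y.
        (r' (x \<otimes> s) * r (y \<otimes> t)) *\<^sub>C q)))"
    by (rule sw_coact_comult[symmetric]) (simp_all add: trilin_def conv_rules)
  also have "\<dots> = sw (coact V v) (\<lambda>p q. counit A p *\<^sub>C (counit A a *\<^sub>C q))"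
    by (simp add: sw_swap[of "comult A p" "comult A a" for p] scaleC_sw_left[symmetric] r'_r_inverse)
      (simp add: scaleC_scaleC mult.commute)
  also have "\<dots> = counit A a *\<^sub>C v"
    by (rule sw_coact_counit) (simp_all add: conv_rules)
  finally show ?thesis .
qed

text \<open>By \<open>inv_act_inv_act\<close> the map \<open>inv_act (unit A)\<close> is idempotent,
  and \<open>act_inv_act\<close> at the unit gives it a left inverse; an idempotent with a left
  inverse is the identity.\<close>

lemma inv_act_unit: "inv_act (unit A) v = v"
  using act_inv_act[of "unit A" "inv_act (unit A) v"] act_inv_act[of "unit A" v]
  by (simp add: sw_comult_unit conv_rules act_lin_rules inv_act_rules inv_act_inv_act mult_unit_left
      counit_unit)

lemma act_act: "act V (mult A (a \<otimes> b) \<otimes> v) = act V (a \<otimes> act V (b \<otimes> v))"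
proof -
  let ?C = "comult A" and ?P = "\<lambda>x v. act V (x \<otimes> v)"
  note rules = conv_rules act_lin_rules inv_act_rules
  \<comment> \<open>Apply \<open>a\<^sub>2b\<^sub>2\<close> after its inverse: the inverse action, being anti-multiplicative, cancels
    \<open>?P a\<^sub>1\<close> and \<open>?P b\<^sub>1\<close> in turn.\<close>
  have "?P a (?P b v) = sw (?C a) (\<lambda>a1 a2. counit A a2 *\<^sub>C
      sw (?C b) (\<lambda>b1 b2. counit A b2 *\<^sub>C ?P a1 (?P b1 v)))"
    by (subst sw_counit_right, simp add: rules)+ (rule refl)
  also have "\<dots> = sw (?C a) (\<lambda>a1 a2. sw (?C b) (\<lambda>b1 b2.
      sw (?C (mult A (a2 \<otimes> b2))) (\<lambda>x y. ?P y (inv_act x (?P a1 (?P b1 v))))))"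
    by (simp add: act_inv_act counit_mult scaleC_sw scaleC_scaleC)
  also have "\<dots> = sw (?C a) (\<lambda>a1 a2. sw (?C b) (\<lambda>b1 b2. sw (?C a2) (\<lambda>u x. sw (?C b2) (\<lambda>w y.
      ?P (mult A (x \<otimes> y)) (inv_act w (inv_act u (?P a1 (?P b1 v))))))))"
    by (simp add: sw_comult_mult inv_act_inv_act rules)
  also have "\<dots> = sw (?C a) (\<lambda>a2 x. sw (?C b) (\<lambda>b2 y. sw (?C a2) (\<lambda>a1 u. sw (?C b2) (\<lambda>b1 w.
      ?P (mult A (x \<otimes> y)) (inv_act w (inv_act u (?P a1 (?P b1 v))))))))"
    by (rule sw_coassoc2[symmetric]) (simp_all add: rules)
  also have "\<dots> = sw (?C a) (\<lambda>a2 x. sw (?C b) (\<lambda>b2 y. ?P (mult A (x \<otimes> y)) (sw (?C b2) (\<lambda>b1 w.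
      inv_act w (sw (?C a2) (\<lambda>a1 u. inv_act u (?P a1 (?P b1 v))))))))"
    by (subst sw_swap) (simp add: rules)
  also have "\<dots> = sw (?C a) (\<lambda>a2 x. counit A a2 *\<^sub>C sw (?C b) (\<lambda>b2 y. counit A b2 *\<^sub>C
      ?P (mult A (x \<otimes> y)) v))"
    by (simp only: inv_act_act clinear_scale[OF inv_act_lin(1)] scaleC_sw[symmetric]
        tensor_scaleC_right clinear_scale[OF act_lin])
  also have "\<dots> = ?P (mult A (a \<otimes> b)) v"
    by (subst sw_counit_left, simp add: rules)+ (rule refl)
  finally show ?thesis ..
qed

lemma act_unit: "act V (unit A \<otimes> v) = v"
  using act_inv_act[of "unit A" v]
  by (simp add: sw_comult_unit conv_rules act_lin_rules inv_act_rules inv_act_unit counit_unit)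

lemma left_module: "left_module A V"
proof (intro left_module.intro act_lin act_unit additive_eq_on_tensors)
  fix t v
  show "(act V \<circ> (mult A \<otimes>\<^sub>m id)) (t \<otimes> v) = (act V \<circ> (id \<otimes>\<^sub>m act V) \<circ> assoc) (t \<otimes> v)"
    by (rule clinear_tensor_eqI[where t = t]) (simp_all add: act_act act_lin_rules conv_rules)
qed (simp_all add: clinear_additive act_lin_rules mult_rules clinear_rules)

text \<open>After merging the coaction that defines the action with the given one, the claim becomes
  \<open>r'_mult_commute\<close> for \<open>a\<close> and the \<A>-leg of \<open>v\<close>.\<close>

lemma yetter_drinfeld:
  "sw (comult A a) (\<lambda>x y. sw (coact V v) (\<lambda>p q. mult A (x \<otimes> p) \<otimes> act V (y \<otimes> q))) =
    sw (comult A a) (\<lambda>x y. sw (coact V (act V (x \<otimes> v))) (\<lambda>p q. mult A (p \<otimes> y) \<otimes> q))"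
proof -
  have "sw (comult A a) (\<lambda>x y. sw (coact V v) (\<lambda>p q. mult A (x \<otimes> p) \<otimes> act V (y \<otimes> q))) =
      sw (coact V v) (\<lambda>p q. sw (coact V q) (\<lambda>s t. sw (comult A a) (\<lambda>x y.
        (r' (y \<otimes> s) *\<^sub>C mult A (x \<otimes> p)) \<otimes> t)))"
    by (simp add: act_sw conv_rules coact_rules tensor_scaleC_left tensor_scaleC_right
        sw_swap[of "comult A a"])
  also have "\<dots> = sw (coact V v) (\<lambda>p q. sw (comult A p) (\<lambda>s t. sw (comult A a) (\<lambda>x y.
        (r' (y \<otimes> t) *\<^sub>C mult A (x \<otimes> s)) \<otimes> q)))"
    by (rule sw_coact_comult[symmetric]) (simp_all add: trilin_def conv_rules)
  also have "\<dots> = sw (coact V v) (\<lambda>p q. sw (comult A p) (\<lambda>s t. sw (comult A a) (\<lambda>x y.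
        (r' (x \<otimes> s) *\<^sub>C mult A (t \<otimes> y)) \<otimes> q)))"
    by (simp add: sw_swap[of "comult A p" "comult A a" for p] tensor_sw_left[symmetric]
        r'_mult_commute)
  also have "\<dots> = sw (coact V v) (\<lambda>p q. sw (coact V q) (\<lambda>s t. sw (comult A a) (\<lambda>x y.
        (r' (x \<otimes> p) *\<^sub>C mult A (s \<otimes> y)) \<otimes> t)))"
    by (rule sw_coact_comult) (simp_all add: trilin_def conv_rules)
  also have "\<dots> = sw (comult A a) (\<lambda>x y. sw (coact V (act V (x \<otimes> v))) (\<lambda>p q. mult A (p \<otimes> y) \<otimes> q))"
    by (simp add: act_sw conv_rules coact_rules tensor_scaleC_left tensor_scaleC_right
        sw_swap[of "comult A a"])
  finally show ?thesis .
qed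

text \<open>The reality condition on the R-form makes conjugation exchange \<open>r'\<close> with
  \<open>r\<close>, so conjugating the action produces its convolution inverse.\<close>

lemma invol_act: "invol V (act V (star A x \<otimes> v)) = inv_act x (invol V v)"
proof -
  have "cnj (r' (star A x \<otimes> p)) = r (x \<otimes> star A p)" for p
    by (simp add: r_star tensor_map_antilinear star_antilinear star_star)
  then show ?thesis
    by (simp add: inv_act_def act_sw sw_coact_invol star_antilinear conv_rules
        antilinear_sw[OF invol_antilinear] antilinear_scale[OF invol_antilinear])
qed

end

lemma bosonization_data_coquasitriangular:
  assumes "coquasitriangular_star_bialgebra A r r'" "coquasitriangular_object A r' V"
    "braided_star_bialgebra A V B"
  shows "bosonization_data A V B"
proof -
  interpret coquasitriangular_action A r r' V
    using assms(1,2) by (rule coquasitriangular_action.intro)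
  show ?thesis
    by (intro bosonization_data.intro bosonization_data_axioms.intro assms(3) left_module
        star_bialgebra_axioms star_comodule_axioms yetter_drinfeld)
      (simp add: invol_act act_inv_act)
qed

theorem theorem5p4p1:
  fixes A :: "'a::complex_vector bialg" and B :: "'b::complex_vector bialg"
    and S :: "'a \<Rightarrow> 'a" and r r' :: "'a \<otimes> 'a \<Rightarrow> complex"
    and \<alpha> :: "'a \<otimes> 'b \<Rightarrow> 'b" and \<gamma> :: "'b \<Rightarrow> 'a \<otimes> 'b"
  assumes "hopf_star_algebra A S \<and>
        hopf_object A S \<lparr>act = \<alpha>, coact = \<gamma>, invol = star B\<rparr> \<or>
      coquasitriangular_star_bialgebra A r r' \<and>
        coquasitriangular_object A r' \<lparr>act = \<alpha>, coact = \<gamma>, invol = star B\<rparr>"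
    and "braided_star_bialgebra A \<lparr>act = \<alpha>, coact = \<gamma>, invol = star B\<rparr> B"
  shows "let H = bosonization A \<alpha> \<gamma> B;
      \<iota> = (\<lambda>b. b \<otimes> unit A);
      \<pi> = runit \<circ> (id \<otimes>\<^sub>m counit A)
    in star_bialgebra H \<and>
      star_algebra_iso_onto B H \<iota> {b \<otimes> unit A | b. True} \<and>
      comult H \<circ> \<iota> = (id \<otimes>\<^sub>m \<iota>) \<circ> assoc' \<circ> (id \<otimes>\<^sub>m \<gamma>) \<circ> comult B \<and>
      (\<pi> \<otimes>\<^sub>m \<pi>) \<circ> comult H = comult B \<circ> \<pi>"
proof -
  interpret bosonization_data A "\<lparr>act = \<alpha>, coact = \<gamma>, invol = star B\<rparr>" B
    using assms bosonization_data_hopf bosonization_data_coquasitriangular by blast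
  have H: "H = bosonization A \<alpha> \<gamma> B"
    by (simp add: H_def)
  show ?thesis
    unfolding Let_def H[symmetric]
    using H_star_bialgebra H_embedding H_comult_embedding H_comult_projection[OF refl] by simp
qed

end
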